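(* Let $\lambda>0$ and let $V^\lambda$ be the unique solution on $\mathbb{R}^3$ of the semilinear elliptic equation $$\frac{\Delta}{2}V^\lambda=\frac12(V^\lambda)^2-\lambda\delta_0,\qquad V^\lambda>0,$$ interpreted in the distributional sense. Then $$\frac{V^\lambda(x)-\lambda/(2\pi|x|)}{\lambda^2\log(1/|x|)/(4\pi^2)}\ \to\ -1,\qquad\text{as }x\to0\text{ in }\mathbb{R}^3.$$
   Context: $\delta_0$ is the Dirac mass at $0$. It is known that the solution $V^\lambda$ exists and is unique, is smooth on $\mathbb{R}^3\setminus\{0\}$, vanishes at infinity, and satisfies $V^\lambda(x)/(\lambda/(2\pi|x|))\to1$ as $x\to0$. It is also known that $E_\mu[\exp(-\lambda L_\infty^x)]=\exp(-\int V^\lambda(y-x)\,\mu(dy))$, where $L_\infty^x$ is the total local time at $x$ of a super-Brownian motion in $\mathbb{R}^3$ started from the finite measure $\mu$ (with branching normalized so that the martingale part $M_t(\phi)$ of $X_t(\phi)$ has quadratic variation $\int_0^tX_s(\phi^2)\,ds$ and the drift is $\int_0^tX_s(\frac\Delta2\phi)\,ds$). *)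

theory Defs
  imports "HOL-Analysis.Analysis"
begin

definition partial_deriv ::
  "'a::euclidean_space \<Rightarrow> ('a \<Rightarrow> real) \<Rightarrow> 'a \<Rightarrow> real" where
  "partial_deriv b f x = deriv (\<lambda>t::real. f (x + t *\<^sub>R b)) 0"

definition laplacian :: "('a::euclidean_space \<Rightarrow> real) \<Rightarrow> 'a \<Rightarrow> real" where
  "laplacian f x = (\<Sum>b\<in>Basis. partial_deriv b (partial_deriv b f) x)"

primrec C_k :: "nat \<Rightarrow> ('a::euclidean_space \<Rightarrow> real) \<Rightarrow> bool" where
  "C_k 0 f \<longleftrightarrow> continuous_on UNIV f"
| "C_k (Suc k) f \<longleftrightarrow>
     (\<forall>x. f differentiable (at x)) \<and> (\<forall>b\<in>Basis. C_k k (partial_deriv b f))"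

definition test_fun :: "('a::euclidean_space \<Rightarrow> real) \<Rightarrow> bool" where
  "test_fun \<phi> \<longleftrightarrow> (\<forall>k. C_k k \<phi>) \<and> compact (closure {x. \<phi> x \<noteq> 0})"

definition locally_integrable :: "('a::euclidean_space \<Rightarrow> real) \<Rightarrow> bool" where
  "locally_integrable f \<longleftrightarrow> (\<forall>K. compact K \<longrightarrow> set_integrable lborel K f)"

(* V is a positive solution on R^3 of
     (Delta/2) V = (1/2) V^2 - l delta_0
   in the sense of distributions; local integrability of V and V^2 is what makes
   both sides distributions.  A distribution determines V only up to null sets, and
   the conclusion of interest is pointwise, so continuity off the origin selects the
   regular representative.  The value V 0 is irrelevant.  No behaviour at 0 or at
   infinity is built in. *)
definition positive_solution :: "real \<Rightarrow> (real ^ 3 \<Rightarrow> real) \<Rightarrow> bool" where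
  "positive_solution l V \<longleftrightarrow>
     (\<forall>x. x \<noteq> 0 \<longrightarrow> V x > 0) \<and>
     continuous_on (UNIV - {0}) V \<and>
     locally_integrable V \<and> locally_integrable (\<lambda>x. (V x)\<^sup>2) \<and>
     (\<forall>\<phi>. test_fun \<phi> \<longrightarrow>
        (LINT x|lborel. V x * (laplacian \<phi> x / 2)) =
        (LINT x|lborel. (V x)\<^sup>2 / 2 * \<phi> x) - l * \<phi> 0)"

end

(* Testing the equation against eta(y) (|y - x|^2 + e)^(-1/2), where eta is a smooth cutoff equal to 1 near 0,
   and letting e tend to 0 shows, with a = l / (2 pi) and W the potential of eta V^2,
     4 pi V(x) = 4 pi a / |x| - W(x) + O(1),    W(x) = integral eta(y) V(y)^2 / |y - x| dy,
   because the Laplacian of the regularised kernel is minus an approximate identity of mass 4 pi.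
   As W >= 0, this gives V <= a / |x| + O(1), so V^2 = O(|x|^(-2)) and W = O(log (1/|x|)); hence
   |x| V(x) tends to a, and then W(x) ~ 4 pi a^2 log (1/|x|), as claimed. *)
theory Submission
  imports Defs "HOL-Real_Asymp.Real_Asymp"
begin

text \<open>Near 0 only positivity, continuity off 0 and local integrability of V and V^2 are given,
  and nothing is given at infinity; this shapes the proof. The cutoff makes every integral local,
  and its derivatives live on 1 <= |y| <= 2, where for |x| < 1/2 the kernel and its gradient are
  bounded uniformly in e; that is the source of the O(1). Since 1/|y - x| is not a test function, it
  is softened algebraically: all derivatives of the softened kernel, and the mass of its Laplacian
  in balls, are then explicit. A test function must be \<open>C_k\<close> for all k, hence a class
  of functions closed under \<open>partial_deriv\<close>.

  The potential W is estimated twice. The sign of W gives a crude constant for V^2 near 0, enough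
  for |x| W(x) to tend to 0; this identifies the limit of |x| V(x), and the second estimate uses
  constants arbitrarily close to a^2. The logarithm is special to dimension 3: the inverse-square
  density, the kernel 1/r and the area 4 pi r^2 combine to 4 pi / r. Dividing 4 pi a^2 log (1/|x|)
  by 4 pi leaves a^2 = l^2 / (4 pi^2), the constant of the theorem.\<close>

subsection \<open>Smooth functions\<close>

text \<open>In rule \<open>smooth_comp\<close> the sequence \<open>h\<close> lists the successive derivatives of \<open>h 0\<close>, required only on
  the range of \<open>u\<close>; this makes the class closed under \<open>partial_deriv\<close>, whence \<open>C_k\<close> for every \<open>k\<close>.\<close>

inductive smooth :: "('a::euclidean_space \<Rightarrow> real) \<Rightarrow> bool" where
  smooth_const: "smooth (\<lambda>x. c)"
| smooth_inner: "smooth (\<lambda>x. x \<bullet> v)"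
| smooth_add: "smooth f \<Longrightarrow> smooth g \<Longrightarrow> smooth (\<lambda>x. f x + g x)"
| smooth_mult: "smooth f \<Longrightarrow> smooth g \<Longrightarrow> smooth (\<lambda>x. f x * g x)"
| smooth_comp: "smooth u \<Longrightarrow>
    (\<And>n y. (h n has_real_derivative h (Suc n) (u y)) (at (u y))) \<Longrightarrow> smooth (\<lambda>x. h 0 (u x))"

lemma partial_derivI:
  assumes "((\<lambda>t. f (x + t *\<^sub>R b)) has_real_derivative d) (at 0)"
  shows "partial_deriv b f x = d"
  unfolding partial_deriv_def using assms by (rule DERIV_imp_deriv)

lemma smooth_imp_differentiable: "smooth f \<Longrightarrow> f differentiable at x"
proof (induction rule: smooth.induct)
  case (smooth_comp u h)
  have "h 0 differentiable at (u x)"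
    using smooth_comp(2)[of 0 x] by (rule differentiableI[OF has_field_derivative_imp_has_derivative])
  then have "(h 0 \<circ> u) differentiable at x"
    using smooth_comp(3) by (rule differentiable_chain_at[rotated])
  then show ?case by (simp add: o_def)
qed (auto intro!: derivative_intros)

lemma differentiable_imp_DERIV_partial_deriv:
  assumes "f differentiable at x"
  shows "((\<lambda>t. f (x + t *\<^sub>R b)) has_real_derivative partial_deriv b f x) (at 0)"
proof -
  have "(\<lambda>t::real. x + t *\<^sub>R b) differentiable at 0"
    by (auto intro!: derivative_intros)
  then have "(f \<circ> (\<lambda>t::real. x + t *\<^sub>R b)) differentiable at 0"
    using assms by (intro differentiable_chain_at) auto
  then show ?thesis unfolding partial_deriv_def
    by (simp add: o_def DERIV_deriv_iff_real_differentiable)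
qed

lemmas smooth_DERIV = differentiable_imp_DERIV_partial_deriv[OF smooth_imp_differentiable]

lemma partial_deriv_const: "partial_deriv b (\<lambda>x. c) = (\<lambda>x. 0)"
  by (rule ext, rule partial_derivI) auto

lemma partial_deriv_inner: "partial_deriv b (\<lambda>x. x \<bullet> v) = (\<lambda>x. b \<bullet> v)"
  by (rule ext, rule partial_derivI) (auto intro!: derivative_eq_intros simp: inner_add_left)

lemma partial_deriv_add:
  assumes "smooth f" "smooth g"
  shows "partial_deriv b (\<lambda>x. f x + g x) = (\<lambda>x. partial_deriv b f x + partial_deriv b g x)"
  by (rule ext, rule partial_derivI) (intro DERIV_add smooth_DERIV assms)

lemma partial_deriv_mult:
  assumes "smooth f" "smooth g"
  shows "partial_deriv b (\<lambda>x. f x * g x)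
       = (\<lambda>x. partial_deriv b f x * g x + f x * partial_deriv b g x)"
  by (rule ext, rule partial_derivI)
     (use DERIV_mult[OF smooth_DERIV[OF assms(1)] smooth_DERIV[OF assms(2)]] in \<open>simp add: mult.commute\<close>)

lemma partial_deriv_comp:
  assumes "smooth u" and "\<And>y. (h has_real_derivative h' (u y)) (at (u y))"
  shows "partial_deriv b (\<lambda>x. h (u x)) = (\<lambda>x. h' (u x) * partial_deriv b u x)"
proof (rule ext, rule partial_derivI)
  fix x
  have "(h has_real_derivative h' (u x)) (at (u (x + 0 *\<^sub>R b)))"
    using assms(2)[of x] by simp
  from DERIV_chain2[OF this smooth_DERIV[OF assms(1)]]
  show "((\<lambda>t. h (u (x + t *\<^sub>R b))) has_real_derivative h' (u x) * partial_deriv b u x) (at 0)" .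
qed

lemma smooth_partial_deriv: "smooth f \<Longrightarrow> smooth (partial_deriv b f)"
proof (induction rule: smooth.induct)
  case (smooth_comp u h)
  \<comment> \<open>Dropping the first entry of \<open>h\<close> leaves a sequence of successive
    derivatives again, so the same rule covers \<open>h (Suc 0)\<close>.\<close>
  have "smooth (\<lambda>x. h (Suc 0) (u x))"
    using smooth.smooth_comp[of u "\<lambda>n. h (Suc n)"] smooth_comp by blast
  then have "smooth (\<lambda>x. h (Suc 0) (u x) * partial_deriv b u x)"
    using smooth_comp by (intro smooth_mult)
  then show ?case using partial_deriv_comp[of u "h 0" "h (Suc 0)" b] smooth_comp by simp
qed (auto simp: partial_deriv_const partial_deriv_inner partial_deriv_add partial_deriv_mult
          intro: smooth_const smooth_add smooth_mult)

lemma smooth_continuous: "smooth f \<Longrightarrow> continuous_on S f"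
  by (meson continuous_at_imp_continuous_on differentiable_imp_continuous_within smooth_imp_differentiable)

lemma smooth_C_k: "smooth f \<Longrightarrow> C_k k f"
  by (induction k arbitrary: f)
     (auto simp: smooth_imp_differentiable smooth_partial_deriv intro: smooth_continuous)

lemma smooth_laplacian: "smooth f \<Longrightarrow> smooth (laplacian f)"
proof -
  assume f: "smooth f"
  have "finite B \<Longrightarrow> smooth (\<lambda>x. \<Sum>b\<in>B. partial_deriv b (partial_deriv b f) x)" for B
    by (induction B rule: finite_induct) (simp_all add: smooth_const smooth_add smooth_partial_deriv f)
  then show ?thesis unfolding laplacian_def[abs_def] by simp
qed

lemma laplacian_mult:
  assumes "smooth f" "smooth g"
  shows "laplacian (\<lambda>x. f x * g x) x = laplacian f x * g x
     + 2 * (\<Sum>b\<in>Basis. partial_deriv b f x * partial_deriv b g x) + f x * laplacian g x"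
proof -
  have "partial_deriv b (partial_deriv b (\<lambda>x. f x * g x)) x
     = partial_deriv b (partial_deriv b f) x * g x + 2 * (partial_deriv b f x * partial_deriv b g x)
      + f x * partial_deriv b (partial_deriv b g) x" for b
    by (simp add: assms partial_deriv_mult partial_deriv_add smooth_partial_deriv smooth_mult)
  then show ?thesis
    by (simp add: laplacian_def sum.distrib sum_distrib_left sum_distrib_right)
qed

text \<open>The line through \<open>x\<close> stays in the open set for small t, and the derivative
  at t = 0 sees nothing else. With the unit ball and the complement of the closed ball of radius 2
  as \<open>U\<close>, this removes all derivatives of the cutoff off the shell between
  them.\<close>

lemma partial_deriv_locally_const:
  assumes "open U" "\<And>y. y \<in> U \<Longrightarrow> f y = c" "x \<in> U"
  shows "partial_deriv b f x = 0"
proof (rule partial_derivI)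
  have "isCont (\<lambda>t::real. x + t *\<^sub>R b) 0" by (intro continuous_intros)
  then have "((\<lambda>t::real. x + t *\<^sub>R b) \<longlongrightarrow> x) (nhds 0)"
    using tendsto_at_iff_tendsto_nhds[of "\<lambda>t::real. x + t *\<^sub>R b" 0] by (simp add: isCont_def)
  then have "\<forall>\<^sub>F t in nhds 0. x + t *\<^sub>R b \<in> U"
    by (rule topological_tendstoD) (use assms in auto)
  then have "\<forall>\<^sub>F t in nhds 0. f (x + t *\<^sub>R b) = c"
    by eventually_elim (use assms in auto)
  then have "((\<lambda>t. f (x + t *\<^sub>R b)) has_real_derivative 0) (at 0) \<longleftrightarrow> ((\<lambda>t. c) has_real_derivative 0) (at 0)"
    by (intro DERIV_cong_ev) auto
  then show "((\<lambda>t. f (x + t *\<^sub>R b)) has_real_derivative 0) (at 0)" by simp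
qed

text \<open>The first partial derivatives vanish on all of \<open>U\<close>, so they are themselves
  locally constant there.\<close>

lemma laplacian_locally_const:
  assumes "open U" "\<And>y. y \<in> U \<Longrightarrow> f y = c" "x \<in> U"
  shows "laplacian f x = 0"
  unfolding laplacian_def
  by (intro sum.neutral ballI partial_deriv_locally_const[OF assms(1) _ assms(3), of _ 0])
     (rule partial_deriv_locally_const[OF assms(1,2)])

subsection \<open>A smooth cutoff function\<close>

text \<open>The functions \<open>p(1/t) exp(-1/t)\<close>, with \<open>p\<close> a polynomial, are closed under differentiation.\<close>

definition flat_exp :: "real poly \<Rightarrow> real \<Rightarrow> real" where
  "flat_exp p t = (if t > 0 then poly p (1 / t) * exp (- (1 / t)) else 0)"

text \<open>In the variable s = 1/t, differentiation in t is -s^2 times differentiation in s, and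
  the s-derivative of p(s) exp(-s) is (p' - p)(s) exp(-s).\<close>

definition flat_exp_deriv :: "real poly \<Rightarrow> real poly" where
  "flat_exp_deriv p = monom 1 2 * (p - pderiv p)"

lemma poly_exp_tendsto_0: "((\<lambda>s. poly p s * exp (- s)) \<longlongrightarrow> (0::real)) at_top"
proof -
  have "((\<lambda>s. coeff p i * (s ^ i / exp s)) \<longlongrightarrow> coeff p i * 0) at_top" for i
    by (intro tendsto_mult tendsto_power_div_exp_0 tendsto_const)
  then have "((\<lambda>s. \<Sum>i\<le>degree p. coeff p i * (s ^ i / exp s)) \<longlongrightarrow> (\<Sum>i\<le>degree p. coeff p i * 0)) at_top"
    by (intro tendsto_sum)
  then show ?thesis
    by (simp add: poly_altdef sum_distrib_right sum_divide_distrib exp_minus divide_inverse mult.assoc)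
qed

lemma flat_exp_has_derivative:
  "(flat_exp p has_real_derivative flat_exp (flat_exp_deriv p) t) (at t)"
proof -
  consider "t > 0" | "t < 0" | "t = 0" by linarith
  then show ?thesis
  proof cases
    case 1
    have "((\<lambda>t. poly p (1 / t) * exp (- (1 / t))) has_real_derivative
        flat_exp (flat_exp_deriv p) t) (at t)"
      using 1 by (auto intro!: derivative_eq_intros poly_DERIV[THEN DERIV_chain2]
          simp: flat_exp_def flat_exp_deriv_def poly_monom field_simps power2_eq_square)
    moreover have "\<forall>\<^sub>F s in nhds t. flat_exp p s = poly p (1 / s) * exp (- (1 / s))"
      using eventually_nhds_in_open[of "{0<..}" t] 1
      by (auto elim!: eventually_mono simp: flat_exp_def)
    ultimately show ?thesis by (subst DERIV_cong_ev[OF refl _ refl]) auto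
  next
    case 2
    have "\<forall>\<^sub>F s in nhds t. flat_exp p s = 0"
      using eventually_nhds_in_open[of "{..<0}" t] 2
      by (auto elim!: eventually_mono simp: flat_exp_def)
    with 2 show ?thesis by (subst DERIV_cong_ev[OF refl _ refl, where g = "\<lambda>_. 0"]) (auto simp: flat_exp_def)
  next
    case 3
    have "((\<lambda>h. flat_exp p h / h) \<longlongrightarrow> 0) (at_right 0)"
    proof -
      \<comment> \<open>Dividing by h multiplies the polynomial by s = 1/h, which is what
        \<open>pCons 0 p\<close> expresses; the exponential still wins.\<close>
      have "((\<lambda>h. poly (pCons 0 p) (inverse h) * exp (- inverse h)) \<longlongrightarrow> (0::real)) (at_right 0)"
        by (rule filterlim_compose[OF poly_exp_tendsto_0 filterlim_inverse_at_top_right])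
      then show ?thesis
        by (rule Lim_transform_eventually)
           (auto simp: eventually_at_filter flat_exp_def field_simps)
    qed
    moreover have "((\<lambda>h. flat_exp p h / h) \<longlongrightarrow> 0) (at_left 0)"
      by (rule Lim_transform_eventually[OF tendsto_const])
         (auto simp: eventually_at_filter flat_exp_def)
    ultimately have "((\<lambda>h. flat_exp p h / h) \<longlongrightarrow> 0) (at 0)"
      by (rule filterlim_split_at[rotated])
    then show ?thesis using 3 by (simp add: DERIV_def flat_exp_def)
  qed
qed

lemma smooth_flat_exp: "smooth u \<Longrightarrow> smooth (\<lambda>x. flat_exp p (u x))"
  using smooth_comp[of u "\<lambda>n. flat_exp ((flat_exp_deriv ^^ n) p)"]
  by (simp add: flat_exp_has_derivative)

section \<open>Real powers and the squared distance as smooth functions\<close>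

lemma powr_deriv_sequence:
  assumes "(s::real) > 0"
  shows "((\<lambda>s. (\<Prod>i<n. a - real i) * s powr (a - real n)) has_real_derivative
      (\<Prod>i<Suc n. a - real i) * s powr (a - real (Suc n))) (at s)"
  using assms by (auto intro!: derivative_eq_intros simp: algebra_simps)

text \<open>\<open>smooth_comp\<close> asks for derivatives only at values of \<open>u\<close>,
  hence only at positive arguments, where the falling factorials of
  \<open>powr_deriv_sequence\<close> give them.\<close>

lemma smooth_powr:
  assumes "smooth u" "\<And>x. u x > 0"
  shows "smooth (\<lambda>x. u x powr a)"
  using smooth_comp[OF assms(1), of "\<lambda>n s. (\<Prod>i<n. a - real i) * s powr (a - real n)"]
    powr_deriv_sequence[OF assms(2)] by simp

lemma smooth_sum: "finite B \<Longrightarrow> (\<And>b. b \<in> B \<Longrightarrow> smooth (f b)) \<Longrightarrow> smooth (\<lambda>x. \<Sum>b\<in>B. f b x)"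
  by (induction B rule: finite_induct) (simp_all add: smooth_const smooth_add)

lemma smooth_norm_sq: "smooth (\<lambda>y. (norm (y - x))\<^sup>2)"
proof -
  have "smooth (\<lambda>y. \<Sum>b\<in>Basis. (y \<bullet> b + - (x \<bullet> b)) * (y \<bullet> b + - (x \<bullet> b)))"
    by (intro smooth_sum smooth_const smooth_add smooth_mult smooth_inner) auto
  moreover have "(\<Sum>b\<in>Basis. (y \<bullet> b + - (x \<bullet> b)) * (y \<bullet> b + - (x \<bullet> b))) = (norm (y - x))\<^sup>2" for y
    unfolding power2_norm_eq_inner by (subst euclidean_inner) (simp add: inner_diff_left)
  ultimately show ?thesis by simp
qed

lemma partial_deriv_norm_sq: "partial_deriv b (\<lambda>y. (norm (y - x))\<^sup>2) = (\<lambda>y. 2 * ((y - x) \<bullet> b))"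
  unfolding power2_norm_eq_inner
  by (rule ext, rule partial_derivI)
     (auto intro!: derivative_eq_intros simp: inner_commute algebra_simps)

lemma flat_exp_1: "flat_exp 1 t = (if t > 0 then exp (- (1 / t)) else 0)"
  by (simp add: flat_exp_def)

lemma cutoff_exists:
  obtains \<eta> :: "'a::euclidean_space \<Rightarrow> real" where "smooth \<eta>" "\<And>y. 0 \<le> \<eta> y" "\<And>y. \<eta> y \<le> 1"
    "\<And>y. norm y < 1 \<Longrightarrow> \<eta> y = 1" "\<And>y. norm y \<ge> 2 \<Longrightarrow> \<eta> y = 0"
proof
  \<comment> \<open>For |y| <= 1 the inner \<open>flat_exp\<close> is 0, which leaves exp(1) exp(-1)
    = 1. For |y| >= 2 its argument is at least 3, so its value is at least exp(-1) >= 1/3; the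
    factor 3 then makes the outer argument nonpositive and the product 0.\<close>
  define \<eta> where "\<eta> = (\<lambda>y::'a. exp 1 * flat_exp 1 (1 + (-3) * flat_exp 1 ((norm (y - 0))\<^sup>2 + (-1))))"
  show "smooth \<eta>" unfolding \<eta>_def
    by (intro smooth_mult smooth_const smooth_flat_exp smooth_add smooth_norm_sq)
  show "0 \<le> \<eta> y" for y by (simp add: \<eta>_def flat_exp_1)
  show "\<eta> y \<le> 1" for y
  proof -
    have "flat_exp 1 s \<le> exp (-1)" if "s \<le> 1" for s
      using that by (auto simp: flat_exp_1 field_simps)
    then have "\<eta> y \<le> exp 1 * exp (-1)" unfolding \<eta>_def
      by (intro mult_left_mono) (auto simp: flat_exp_1)
    then show ?thesis by (simp flip: exp_add)
  qed
  show "\<eta> y = 1" if "norm y < 1" for y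
  proof -
    have "(norm y)\<^sup>2 \<le> 1" using that by (simp add: power_le_one)
    then show ?thesis by (simp add: \<eta>_def flat_exp_1 flip: exp_add)
  qed
  show "\<eta> y = 0" if "norm y \<ge> 2" for y
  proof -
    have 1: "(norm y)\<^sup>2 \<ge> 2\<^sup>2" using that by (intro power_mono) auto
    then have "1 / ((norm y)\<^sup>2 - 1) \<le> 1" by (simp add: field_simps)
    then have "exp (1 / ((norm y)\<^sup>2 - 1)) \<le> 3"
      using exp_le by (meson exp_le_cancel_iff order_trans)
    then have "1 \<le> 3 * exp (- (1 / ((norm y)\<^sup>2 - 1)))"
      by (simp add: exp_minus field_simps)
    then show ?thesis using 1 by (simp add: \<eta>_def flat_exp_1)
  qed
qed

subsection \<open>The regularised Newton kernel\<close>

text \<open>The Newton kernel 1/|y - x| softened at length sqrt(e), known (up to sign and mass) as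
  the potential of Plummer's star cluster model. For e > 0 it is smooth in \<open>y\<close>, also at
  \<open>x\<close>.\<close>

definition plummer_potential :: "real \<Rightarrow> 'a::euclidean_space \<Rightarrow> 'a \<Rightarrow> real" where
  "plummer_potential e x y = ((norm (y - x))\<^sup>2 + e) powr (- 1 / 2)"

lemma smooth_shifted_norm_sq: "smooth (\<lambda>y. (norm (y - x))\<^sup>2 + e)"
  by (intro smooth_add smooth_const smooth_norm_sq)

lemma shifted_norm_sq_pos: "e > 0 \<Longrightarrow> (norm (y - x))\<^sup>2 + e > 0" for e :: real
  by (simp add: add_nonneg_pos)

lemma smooth_shifted_norm_sq_powr: "e > 0 \<Longrightarrow> smooth (\<lambda>y. ((norm (y - x))\<^sup>2 + e) powr a)"
  by (intro smooth_powr smooth_shifted_norm_sq shifted_norm_sq_pos)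

lemma smooth_plummer_potential: "e > 0 \<Longrightarrow> smooth (plummer_potential e x)"
  unfolding plummer_potential_def[abs_def] by (rule smooth_shifted_norm_sq_powr)

lemma partial_deriv_shifted_norm_sq_powr:
  assumes "e > 0"
  shows "partial_deriv b (\<lambda>y. ((norm (y - x))\<^sup>2 + e) powr a)
       = (\<lambda>y. (2 * a * ((norm (y - x))\<^sup>2 + e) powr (a - 1)) * ((y - x) \<bullet> b))"
proof -
  have "((\<lambda>s. s powr a) has_real_derivative a * ((norm (y - x))\<^sup>2 + e) powr (a - 1))
      (at ((norm (y - x))\<^sup>2 + e))" for y
    using shifted_norm_sq_pos[OF assms, of y x] by (auto intro!: derivative_eq_intros)
  from partial_deriv_comp[where h = "\<lambda>s. s powr a" and h' = "\<lambda>s. a * s powr (a - 1)",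
      OF smooth_shifted_norm_sq[of x e], OF this, of b]
  show ?thesis
    by (simp add: partial_deriv_add[OF smooth_norm_sq smooth_const] partial_deriv_norm_sq
        partial_deriv_const mult.commute mult.left_commute mult.assoc)
qed

lemma partial_deriv_inner_diff: "partial_deriv b (\<lambda>y. (y - x) \<bullet> v) = (\<lambda>y. b \<bullet> v)"
  by (rule ext, rule partial_derivI) (auto intro!: derivative_eq_intros simp: inner_add_left inner_diff_left)

lemma smooth_inner_diff: "smooth (\<lambda>y. (y - x) \<bullet> v)"
  using smooth_add[OF smooth_inner[of v] smooth_const[of "- (x \<bullet> v)"]] by (simp add: inner_diff_left)

lemma partial_deriv_plummer_potential:
  assumes "e > 0"
  shows "partial_deriv b (plummer_potential e x) = (\<lambda>y. (- (((norm (y - x))\<^sup>2 + e) powr (- 3 / 2))) * ((y - x) \<bullet> b))"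
  unfolding plummer_potential_def[abs_def] partial_deriv_shifted_norm_sq_powr[OF assms] by simp

text \<open>With q = |y - x|^2 + e, summing over the three coordinates gives -3 q^(-3/2) + 3 |y -
  x|^2 q^(-5/2). Writing q^(-3/2) as q * q^(-5/2) cancels the |y - x|^2 terms, exactly because the
  dimension is 3, and only the term with e survives.\<close>

lemma laplacian_plummer_potential:
  fixes x y :: "real ^ 3"
  assumes "e > 0"
  shows "laplacian (plummer_potential e x) y = - 3 * e * ((norm (y - x))\<^sup>2 + e) powr (- 5 / 2)"
proof -
  let ?q = "(norm (y - x))\<^sup>2 + e"
  have q: "?q powr (- 3 / 2) = ?q * ?q powr (- 5 / 2)"
    using powr_add[of ?q 1 "- 5 / 2"] shifted_norm_sq_pos[OF assms, of y x] by simp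
  have "partial_deriv b (partial_deriv b (plummer_potential e x)) y
     = - (?q powr (- 3 / 2)) + 3 * ?q powr (- 5 / 2) * ((y - x) \<bullet> b)\<^sup>2" if "b \<in> Basis" for b
  proof -
    have "partial_deriv b (partial_deriv b (plummer_potential e x)) y
      = partial_deriv b (\<lambda>y. (- 1) * ((norm (y - x))\<^sup>2 + e) powr (- 3 / 2)) y * ((y - x) \<bullet> b)
        - (?q powr (- 3 / 2)) * (b \<bullet> b)"
      unfolding partial_deriv_plummer_potential[OF assms]
      using partial_deriv_mult[OF smooth_mult[OF smooth_const[of "- 1"]
        smooth_shifted_norm_sq_powr[OF assms, of x "- 3 / 2"]] smooth_inner_diff[of x b], of b]
      by (simp add: partial_deriv_inner_diff)
    also have "partial_deriv b (\<lambda>y. (- 1) * ((norm (y - x))\<^sup>2 + e) powr (- 3 / 2)) y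
       = 3 * ?q powr (- 5 / 2) * ((y - x) \<bullet> b)"
      by (subst partial_deriv_mult[OF smooth_const smooth_shifted_norm_sq_powr[OF assms]])
         (simp add: partial_deriv_const partial_deriv_shifted_norm_sq_powr[OF assms])
    finally show ?thesis using that by (simp add: power2_eq_square)
  qed
  then have "laplacian (plummer_potential e x) y
      = (\<Sum>b\<in>Basis. - (?q powr (- 3 / 2)) + 3 * ?q powr (- 5 / 2) * ((y - x) \<bullet> b)\<^sup>2)"
    unfolding laplacian_def by (intro sum.cong) auto
  also have "\<dots> = - 3 * ?q powr (- 3 / 2) + 3 * ?q powr (- 5 / 2) * (\<Sum>b\<in>Basis. ((y - x) \<bullet> b)\<^sup>2)"
    by (simp add: sum.distrib sum_distrib_left sum_subtractf)
  also have "(\<Sum>b\<in>Basis. ((y - x) \<bullet> b)\<^sup>2) = (norm (y - x))\<^sup>2"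
    unfolding power2_norm_eq_inner euclidean_inner[of "y - x" "y - x"] by (simp add: power2_eq_square)
  finally show ?thesis unfolding q by (simp add: algebra_simps)
qed

lemma sqrt_eq_powr: "s > 0 \<Longrightarrow> s powr (- 1 / 2) = 1 / sqrt s"
  by (simp add: powr_minus_divide powr_half_sqrt)

lemma plummer_potential_eq: "plummer_potential e x y = 1 / sqrt ((norm (y - x))\<^sup>2 + e)" if "e \<ge> 0"
\<comment> \<open>If the sum is 0, both sides have the default value 0.\<close>
proof (cases "(norm (y - x))\<^sup>2 + e = 0")
  case False
  then show ?thesis unfolding plummer_potential_def using that
    by (intro sqrt_eq_powr) (metis add_nonneg_nonneg less_eq_real_def zero_le_power2)
qed (simp add: plummer_potential_def)

lemma plummer_potential_le: "e \<ge> 0 \<Longrightarrow> y \<noteq> x \<Longrightarrow> plummer_potential e x y \<le> 1 / norm (y - x)"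
  unfolding plummer_potential_eq
  by (intro divide_left_mono real_le_rsqrt) (auto intro!: mult_pos_pos add_pos_nonneg)

lemma plummer_potential_nonneg: "0 \<le> plummer_potential e x y"
  by (simp add: plummer_potential_def)

text \<open>The bound does not involve e. It serves for a = 3/2 (gradient of the softened kernel)
  and a = 5/2 (its Laplacian) away from \<open>x\<close>.\<close>

lemma shifted_norm_sq_powr_le:
  assumes "e > 0" "d > 0" "norm (y - x) \<ge> d" "a \<ge> 0"
  shows "((norm (y - x))\<^sup>2 + e) powr (- a) \<le> 1 / d powr (2 * a)"
proof -
  have "d\<^sup>2 \<le> (norm (y - x))\<^sup>2 + e"
    using assms power_mono[of d "norm (y - x)" 2] by linarith
  then have "(d\<^sup>2) powr a \<le> ((norm (y - x))\<^sup>2 + e) powr a"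
    using assms by (intro powr_mono2) auto
  moreover have "(d\<^sup>2) powr a = d powr (2 * a)"
    using assms by (simp add: powr_powr flip: powr_numeral)
  ultimately show ?thesis
    using assms by (simp add: powr_minus_divide divide_left_mono frac_le)
qed

subsection \<open>Radial integrals in three dimensions\<close>

text \<open>This takes the place of polar coordinates. Both measures give the half-line up to a >= 0
  the volume 4/3 pi a^3 of a ball, and half-lines form an intersection-stable generator of the Borel
  sets.\<close>

lemma distr_norm_lborel:
  "distr (lborel :: (real ^ 3) measure) borel norm
     = density lborel (\<lambda>r. ennreal (4 * pi * r\<^sup>2) * indicator {0..} r)"  (is "?M = ?N")
proof (rule measure_eqI_generator_eq[where E = "range atMost" and \<Omega> = UNIV and A = "\<lambda>n. {..real n}"])
  have M: "emeasure ?M {..a} = (if a \<ge> 0 then ennreal (4 / 3 * pi * a ^ 3) else 0)" for a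
  proof -
    have "norm -` {..a} = cball (0::real^3) a" by auto
    then have "emeasure ?M {..a} = emeasure lborel (cball (0::real^3) a)"
      by (simp add: emeasure_distr)
    then show ?thesis by (auto simp: emeasure_cball unit_ball_vol_3)
  qed
  have N: "emeasure ?N {..a} = (if a \<ge> 0 then ennreal (4 / 3 * pi * a ^ 3) else 0)" for a
  proof -
    have "emeasure ?N {..a} = (\<integral>\<^sup>+r. ennreal (4 * pi * r\<^sup>2) * indicator {0..a} r \<partial>lborel)"
      by (auto simp: emeasure_density intro!: nn_integral_cong split: split_indicator)
    also have "\<dots> = (if a \<ge> 0 then ennreal (4 / 3 * pi * a ^ 3) else 0)"
    proof (cases "a \<ge> 0")
      case True
      then show ?thesis
        by (subst nn_integral_FTC_Icc[where F = "\<lambda>r. 4 / 3 * pi * r ^ 3"])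
           (auto intro!: derivative_eq_intros)
    qed auto
    finally show ?thesis .
  qed
  show "emeasure ?M X = emeasure ?N X" if "X \<in> range atMost" for X
    using that M N by auto
  show "emeasure ?M {..real n} \<noteq> \<infinity>" for n using M by simp
  show "Int_stable (range (atMost :: real \<Rightarrow> real set))" by (auto simp: Int_stable_def)
  show "sets ?M = sigma_sets UNIV (range atMost)" "sets ?N = sigma_sets UNIV (range atMost)"
    by (simp_all add: borel_eq_atMost)
  show "(\<Union>n. {..real n}) = (UNIV :: real set)" by (auto simp: real_arch_simple)
qed auto

lemma nn_integral_radial:
  assumes [measurable]: "f \<in> borel_measurable borel"
  shows "(\<integral>\<^sup>+z. f (norm (z :: real ^ 3)) \<partial>lborel)
       = (\<integral>\<^sup>+r. ennreal (4 * pi * r\<^sup>2) * indicator {0..} r * f r \<partial>lborel)"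
proof -
  have "(\<integral>\<^sup>+z. f (norm (z :: real ^ 3)) \<partial>lborel) = (\<integral>\<^sup>+r. f r \<partial>distr (lborel :: (real ^ 3) measure) borel norm)"
    by (subst nn_integral_distr) auto
  then show ?thesis by (simp add: distr_norm_lborel nn_integral_density)
qed

text \<open>The density \<open>D\<close> is kept apart from \<open>4 \<pi> r\<^sup>2 f r\<close> because \<open>f\<close> may have the junk value \<open>1 / 0 = 0\<close> at \<open>r = 0\<close>.\<close>

lemma nn_integral_shell:
  fixes f F D :: "real \<Rightarrow> real"
  assumes [measurable]: "f \<in> borel_measurable borel" "D \<in> borel_measurable borel"
    and "0 \<le> a" "a \<le> b"
    and F: "\<And>r. a \<le> r \<Longrightarrow> r \<le> b \<Longrightarrow> (F has_real_derivative D r) (at r)"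
    and D: "\<And>r. a \<le> r \<Longrightarrow> r \<le> b \<Longrightarrow> r \<noteq> 0 \<Longrightarrow> D r = 4 * pi * r\<^sup>2 * f r"
    and nonneg: "\<And>r. a \<le> r \<Longrightarrow> r \<le> b \<Longrightarrow> 0 \<le> f r" "\<And>r. a \<le> r \<Longrightarrow> r \<le> b \<Longrightarrow> 0 \<le> D r"
  shows "(\<integral>\<^sup>+z. ennreal (f (norm z) * indicator {z. a \<le> norm z \<and> norm z \<le> b} z) \<partial>(lborel :: (real ^ 3) measure))
       = ennreal (F b - F a)"
proof -
  have "(\<integral>\<^sup>+z. ennreal (f (norm z) * indicator {z. a \<le> norm z \<and> norm z \<le> b} z) \<partial>(lborel :: (real ^ 3) measure))
      = (\<integral>\<^sup>+z. (\<lambda>r. ennreal (f r) * indicator {a..b} r) (norm z) \<partial>(lborel :: (real ^ 3) measure))"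
    by (intro nn_integral_cong) (auto split: split_indicator)
  also have "\<dots> = (\<integral>\<^sup>+r. ennreal (4 * pi * r\<^sup>2) * indicator {0..} r * (ennreal (f r) * indicator {a..b} r) \<partial>lborel)"
    by (rule nn_integral_radial) measurable
  also have "\<dots> = (\<integral>\<^sup>+r. ennreal (D r) * indicator {a..b} r \<partial>lborel)"
  proof (rule nn_integral_cong_AE)
    show "AE r in lborel. ennreal (4 * pi * r\<^sup>2) * indicator {0..} r * (ennreal (f r) * indicator {a..b} r)
        = ennreal (D r) * indicator {a..b} r"
      using AE_lborel_singleton[of "0::real"]
      by eventually_elim (use \<open>0 \<le> a\<close> nonneg D in \<open>auto simp: ennreal_mult split: split_indicator\<close>)
  qed
  also have "\<dots> = ennreal (F b - F a)"
    by (rule nn_integral_FTC_Icc) (use F nonneg \<open>a \<le> b\<close> in auto)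
  finally show ?thesis .
qed

lemma nn_integral_lborel_translate:
  fixes x :: "'a::euclidean_space"
  assumes [measurable]: "f \<in> borel_measurable borel"
  shows "(\<integral>\<^sup>+y. f (y - x) \<partial>lborel) = (\<integral>\<^sup>+y. f y \<partial>lborel)"
proof -
  have "(\<integral>\<^sup>+y. f y \<partial>lborel) = (\<integral>\<^sup>+y. f y \<partial>distr lborel borel ((+) (- x)))"
    by (simp add: lborel_distr_plus)
  also have "\<dots> = (\<integral>\<^sup>+y. f (y - x) \<partial>lborel)"
    by (subst nn_integral_distr) auto
  finally show ?thesis ..
qed

lemma borel_measurable_inverse_norm_ball:
  "(\<lambda>y. 1 / norm (y - x) * indicator (cball x d) y :: real) \<in> borel_measurable borel"
  for x :: "'a::euclidean_space"
proof (intro borel_measurable_times borel_measurable_indicator)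
  show "(\<lambda>y. 1 / norm (y - x)) \<in> borel_measurable borel" by measurable
qed simp

lemma nn_integral_inverse_norm_ball:
  fixes x :: "real ^ 3"
  assumes "d \<ge> 0"
  shows "(\<integral>\<^sup>+y. ennreal (1 / norm (y - x) * indicator (cball x d) y) \<partial>lborel) = ennreal (2 * pi * d\<^sup>2)"
proof -
  have "(\<integral>\<^sup>+y. ennreal (1 / norm (y - x) * indicator (cball x d) y) \<partial>lborel)
      = (\<integral>\<^sup>+y. ennreal (1 / norm (y - x) * indicator {z. 0 \<le> norm z \<and> norm z \<le> d} (y - x)) \<partial>lborel)"
    by (intro nn_integral_cong) (auto simp: dist_norm norm_minus_commute split: split_indicator)
  also have "\<dots> = (\<integral>\<^sup>+z. ennreal (1 / norm z * indicator {z. 0 \<le> norm z \<and> norm z \<le> d} z) \<partial>(lborel :: (real ^ 3) measure))"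
    by (rule nn_integral_lborel_translate
        [where f = "\<lambda>z. ennreal (1 / norm z * indicator {z. 0 \<le> norm z \<and> norm z \<le> d} z)"]) measurable
  also have "\<dots> = ennreal (2 * pi * d\<^sup>2 - 2 * pi * 0\<^sup>2)"
    by (rule nn_integral_shell[where f = "\<lambda>r. 1 / r" and D = "\<lambda>r. 4 * pi * r"])
       (use assms in \<open>auto intro!: derivative_eq_intros simp: power2_eq_square\<close>)
  finally show ?thesis by simp
qed

lemma nn_integral_inverse_norm_sq_ball:
  assumes "d \<ge> 0"
  shows "(\<integral>\<^sup>+z. ennreal (1 / (norm z)\<^sup>2 * indicator {z. 0 \<le> norm z \<and> norm z \<le> d} z) \<partial>(lborel :: (real ^ 3) measure))
     = ennreal (4 * pi * d)"
proof -
  have "((\<lambda>r. 4 * pi * r) has_real_derivative 4 * pi) (at r)" for r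
    by (auto intro!: derivative_eq_intros)
  then show ?thesis
    using nn_integral_shell[of "\<lambda>r. 1 / r\<^sup>2" "\<lambda>_. 4 * pi" 0 d "\<lambda>r. 4 * pi * r"] assms by simp
qed

text \<open>The origin of the logarithm: the area 4 pi r^2 cancels the inverse square and leaves 4
  pi / (r + c). The shift \<open>c\<close> may have either sign, since the bounds |y| - |x| <= |y -
  x| <= |y| + |x| call for c = -|x| and c = |x|.\<close>

lemma nn_integral_log_shell:
  assumes "c > - a" "0 < a" "a \<le> b"
  shows "(\<integral>\<^sup>+z. ennreal (1 / ((norm z + c) * (norm z)\<^sup>2) * indicator {z. a \<le> norm z \<and> norm z \<le> b} z) \<partial>(lborel :: (real ^ 3) measure))
     = ennreal (4 * pi * ln ((b + c) / (a + c)))"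
proof -
  have "4 * pi * ln ((b + c) / (a + c)) = 4 * pi * ln (b + c) - 4 * pi * ln (a + c)"
    using assms by (simp add: ln_div right_diff_distrib)
  moreover have "(\<integral>\<^sup>+z. ennreal (1 / ((norm z + c) * (norm z)\<^sup>2) * indicator {z. a \<le> norm z \<and> norm z \<le> b} z) \<partial>(lborel :: (real ^ 3) measure))
      = ennreal (4 * pi * ln (b + c) - 4 * pi * ln (a + c))"
  proof (rule nn_integral_shell[where f = "\<lambda>r. 1 / ((r + c) * r\<^sup>2)" and D = "\<lambda>r. 4 * pi / (r + c)"])
    fix r assume r: "a \<le> r"
    then have "r + c > 0" using assms by simp
    then show "((\<lambda>r. 4 * pi * ln (r + c)) has_real_derivative 4 * pi / (r + c)) (at r)"
      "0 \<le> 1 / ((r + c) * r\<^sup>2)" "0 \<le> 4 * pi / (r + c)"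
      by (auto intro!: derivative_eq_intros)
    show "4 * pi / (r + c) = 4 * pi * r\<^sup>2 * (1 / ((r + c) * r\<^sup>2))" if "r \<noteq> 0"
      using that by simp
  qed (use assms in auto)
  ultimately show ?thesis by simp
qed

subsection \<open>Newton potentials of inverse-square densities\<close>

text \<open>The regions \<open>|y| \<le> |x|/2\<close> and \<open>|x|/2 < |y| < 2|x|\<close> contribute \<open>O(M)\<close> by scaling; the logarithm comes from \<open>2|x| \<le> |y| \<le> r\<close>.\<close>

lemma newton_potential_upper:
  fixes f :: "real ^ 3 \<Rightarrow> real"
  assumes f: "integrable lborel f" "\<And>y. f y \<ge> 0" and "M \<ge> 0" "0 < r" "r \<le> 1"
    and le: "\<And>y. y \<noteq> 0 \<Longrightarrow> norm y \<le> r \<Longrightarrow> f y \<le> M / (norm y)\<^sup>2"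
    and x: "x \<noteq> 0" "norm x < r / 2"
  shows "(\<integral>\<^sup>+y. ennreal (f y / norm (y - x)) \<partial>lborel)
     \<le> ennreal (2 / r * integral\<^sup>L lborel f + M * (76 * pi + 4 * pi * ln (1 / norm x)))"
proof -
  define s where "s = norm x"
  have s: "s > 0" "2 * s < r" using x by (auto simp: s_def)
  \<comment> \<open>One majorant per region: |y - x| >= s/2 on the inner ball, |y| > s/2 on the
    middle shell, |y - x| >= |y| - s on the outer shell. The radius 3 s in \<open>B\<close> comes
    from |y| < 2 s on the middle shell.\<close>
  define A where "A = (\<lambda>y::real^3. 1 / (norm y)\<^sup>2 * indicator {z. 0 \<le> norm z \<and> norm z \<le> s / 2} y)"
  define B where "B = (\<lambda>y. 1 / norm (y - x) * indicator (cball x (3 * s)) y)"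
  define C where "C = (\<lambda>y::real^3. 1 / ((norm y + - s) * (norm y)\<^sup>2) * indicator {z. 2 * s \<le> norm z \<and> norm z \<le> r} y)"
  have nn: "A y \<ge> 0" "B y \<ge> 0" "C y \<ge> 0" for y
    using s by (auto simp: A_def B_def C_def split: split_indicator)
  have [measurable]: "A \<in> borel_measurable borel" unfolding A_def by measurable
  have [measurable]: "B \<in> borel_measurable borel" unfolding B_def
    by (rule borel_measurable_inverse_norm_ball)
  have [measurable]: "C \<in> borel_measurable borel" unfolding C_def by measurable
  have [measurable]: "f \<in> borel_measurable borel" using f(1) by auto
  have key: "1 / (norm y)\<^sup>2 / norm (y - x) \<le> 2 / s * A y + 4 / s\<^sup>2 * B y + C y"
    if "y \<noteq> 0" "y \<noteq> x" "norm y \<le> r" for y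
  proof -
    have tri: "norm y \<le> norm (y - x) + s" "s \<le> norm (y - x) + norm y" "norm (y - x) \<le> norm y + s"
      unfolding s_def by norm+
    have p: "norm (y - x) > 0" "norm y > 0" using that by auto
    consider "norm y \<le> s / 2" | "s / 2 < norm y" "norm y < 2 * s" | "2 * s \<le> norm y" by linarith
    then show ?thesis
    proof cases
      case 1
      then have "1 / norm (y - x) \<le> 2 / s" using tri p s by (simp add: field_simps)
      then have "1 / (norm y)\<^sup>2 * (1 / norm (y - x)) \<le> 1 / (norm y)\<^sup>2 * (2 / s)"
        by (intro mult_left_mono) auto
      also have "\<dots> = 2 / s * A y" using 1 by (simp add: A_def)
      finally show ?thesis using nn[of y] s by (simp add: add_increasing2)
    next
      case 2
      then have "(s / 2)\<^sup>2 \<le> (norm y)\<^sup>2" using s by (intro power_mono) auto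
      then have "1 / (norm y)\<^sup>2 \<le> 4 / s\<^sup>2" using p s by (simp add: field_simps)
      then have "1 / (norm y)\<^sup>2 * (1 / norm (y - x)) \<le> 4 / s\<^sup>2 * (1 / norm (y - x))"
        by (intro mult_right_mono) auto
      also have "\<dots> = 4 / s\<^sup>2 * B y" using 2 tri by (simp add: B_def dist_norm norm_minus_commute)
      finally show ?thesis using nn[of y] s by (simp add: add_increasing2 add_increasing)
    next
      case 3
      then have "1 / norm (y - x) \<le> 1 / (norm y + - s)" using tri p s by (simp add: field_simps)
      then have "1 / (norm y)\<^sup>2 * (1 / norm (y - x)) \<le> 1 / (norm y)\<^sup>2 * (1 / (norm y + - s))"
        by (intro mult_left_mono) auto
      also have "\<dots> = C y" using 3 that by (simp add: C_def)
      finally show ?thesis using nn[of y] s by (simp add: add_increasing2 add_increasing)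
    qed
  qed
  have collect: "ennreal a * ennreal i + ennreal M * (ennreal b * ennreal p + ennreal c * ennreal q + ennreal w)
      = ennreal (a * i + M * (b * p + c * q + w))"
    if "a \<ge> 0" "i \<ge> 0" "b \<ge> 0" "p \<ge> 0" "c \<ge> 0" "q \<ge> 0" "w \<ge> 0" for a i b p c q w
    using that \<open>M \<ge> 0\<close> by (simp flip: ennreal_mult ennreal_plus)
  have "(\<integral>\<^sup>+y. ennreal (f y / norm (y - x)) \<partial>lborel)
    \<le> (\<integral>\<^sup>+y. ennreal (2 / r) * ennreal (f y) + ennreal M * (ennreal (2 / s) * ennreal (A y)
        + ennreal (4 / s\<^sup>2) * ennreal (B y) + ennreal (C y)) \<partial>lborel)"
  proof (rule nn_integral_mono_AE)
    show "AE y in lborel. ennreal (f y / norm (y - x)) \<le> ennreal (2 / r) * ennreal (f y)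
        + ennreal M * (ennreal (2 / s) * ennreal (A y) + ennreal (4 / s\<^sup>2) * ennreal (B y) + ennreal (C y))"
      using AE_lborel_singleton[of "0::real^3"] AE_lborel_singleton[of x]
    proof eventually_elim
      case (elim y)
      have "f y / norm (y - x) \<le> 2 / r * f y + M * (2 / s * A y + 4 / s\<^sup>2 * B y + C y)"
      proof (cases "norm y \<le> r")
        case True
        have "f y / norm (y - x) \<le> M / (norm y)\<^sup>2 / norm (y - x)"
          using le[of y] True elim by (intro divide_right_mono) auto
        also have "\<dots> = M * (1 / (norm y)\<^sup>2 / norm (y - x))" by simp
        also have "\<dots> \<le> M * (2 / s * A y + 4 / s\<^sup>2 * B y + C y)"
          using key[of y] True elim \<open>M \<ge> 0\<close> by (intro mult_left_mono) auto
        finally show ?thesis using f(2)[of y] \<open>0 < r\<close> by (simp add: add_increasing)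
      next
        case False
        \<comment> \<open>Beyond radius \<open>r\<close> no pointwise bound on \<open>f\<close> is
          available, but \<open>x\<close> is at distance more than r/2, so only the total mass of
          \<open>f\<close> enters.\<close>
        have "norm y \<le> norm (y - x) + s" unfolding s_def by norm
        then have "r / 2 \<le> norm (y - x)" using False s by linarith
        then have "1 / norm (y - x) \<le> 2 / r"
          using \<open>0 < r\<close> frac_le[of 1 1 "r / 2" "norm (y - x)"] by simp
        then have "f y * (1 / norm (y - x)) \<le> f y * (2 / r)"
          using f(2)[of y] by (intro mult_left_mono)
        moreover have "0 \<le> M * (2 / s * A y + 4 / s\<^sup>2 * B y + C y)"
          using \<open>M \<ge> 0\<close> s nn by (intro mult_nonneg_nonneg add_nonneg_nonneg) auto
        ultimately show ?thesis by (simp add: mult.commute)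
      qed
      moreover have "ennreal (2 / r) * ennreal (f y)
        + ennreal M * (ennreal (2 / s) * ennreal (A y) + ennreal (4 / s\<^sup>2) * ennreal (B y) + ennreal (C y))
         = ennreal (2 / r * f y + M * (2 / s * A y + 4 / s\<^sup>2 * B y + C y))"
        by (rule collect) (use nn f(2) s \<open>0 < r\<close> \<open>M \<ge> 0\<close> in auto)
      ultimately show ?case by (simp add: ennreal_leI del: ennreal_plus)
    qed
  qed
  also have "\<dots> = ennreal (2 / r) * ennreal (integral\<^sup>L lborel f) + ennreal M * (ennreal (2 / s) * ennreal (4 * pi * (s / 2))
        + ennreal (4 / s\<^sup>2) * ennreal (2 * pi * (3 * s)\<^sup>2) + ennreal (4 * pi * ln ((r + - s) / (2 * s + - s))))"
  proof -
    have "integral\<^sup>N lborel f = ennreal (integral\<^sup>L lborel f)"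
      by (rule nn_integral_eq_integral) (use f in auto)
    moreover have "integral\<^sup>N lborel A = ennreal (4 * pi * (s / 2))"
      unfolding A_def by (rule nn_integral_inverse_norm_sq_ball) (use s in auto)
    moreover have "integral\<^sup>N lborel B = ennreal (2 * pi * (3 * s)\<^sup>2)"
      unfolding B_def by (rule nn_integral_inverse_norm_ball) (use s in auto)
    moreover have "integral\<^sup>N lborel C = ennreal (4 * pi * ln ((r + - s) / (2 * s + - s)))"
      unfolding C_def by (rule nn_integral_log_shell) (use s in auto)
    ultimately show ?thesis by (simp add: nn_integral_add nn_integral_cmult)
  qed
  also have "\<dots> = ennreal (2 / r * integral\<^sup>L lborel f + M * (2 / s * (4 * pi * (s / 2))
        + 4 / s\<^sup>2 * (2 * pi * (3 * s)\<^sup>2) + 4 * pi * ln ((r + - s) / (2 * s + - s))))"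
    by (rule collect) (use f s \<open>0 < r\<close> \<open>M \<ge> 0\<close> in \<open>auto intro!: mult_nonneg_nonneg\<close>)
  also have "\<dots> \<le> ennreal (2 / r * integral\<^sup>L lborel f + M * (76 * pi + 4 * pi * ln (1 / norm x)))"
  proof -
    have "ln ((r + - s) / (2 * s + - s)) \<le> ln (1 / s)"
      using s \<open>r \<le> 1\<close> by (subst ln_le_cancel_iff) (auto simp: divide_right_mono)
    \<comment> \<open>The inner ball contributes 4 pi and the middle shell 72 pi, both independent
      of \<open>s\<close>; together 76 pi.\<close>
    then have "2 / s * (4 * pi * (s / 2)) + 4 / s\<^sup>2 * (2 * pi * (3 * s)\<^sup>2) + 4 * pi * ln ((r + - s) / (2 * s + - s))
       \<le> 76 * pi + 4 * pi * ln (1 / norm x)"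
      using s by (simp add: power_mult_distrib s_def)
    then show ?thesis using \<open>M \<ge> 0\<close> by (intro ennreal_leI add_left_mono mult_left_mono)
  qed
  finally show ?thesis .
qed

text \<open>Only the shell |x| <= |y| <= r is kept, where |y - x| <= |y| + |x|. This loses a bounded
  multiple of \<open>m\<close>, not the leading logarithm.\<close>

lemma newton_potential_lower:
  fixes f :: "real ^ 3 \<Rightarrow> real"
  assumes f: "f \<in> borel_measurable borel" and "m \<ge> 0"
    and ge: "\<And>y. y \<noteq> 0 \<Longrightarrow> norm y \<le> r \<Longrightarrow> m / (norm y)\<^sup>2 \<le> f y"
    and x: "x \<noteq> 0" "norm x \<le> r"
  shows "ennreal (m * (4 * pi * ln (r / (2 * norm x)))) \<le> (\<integral>\<^sup>+y. ennreal (f y / norm (y - x)) \<partial>lborel)"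
proof -
  define s where "s = norm x"
  have s: "s > 0" "s \<le> r" using x by (auto simp: s_def)
  define C where "C = (\<lambda>y::real^3. 1 / ((norm y + s) * (norm y)\<^sup>2) * indicator {z. s \<le> norm z \<and> norm z \<le> r} y)"
  have [measurable]: "C \<in> borel_measurable borel" unfolding C_def by measurable
  have "ln (r / (2 * s)) \<le> ln ((r + s) / (s + s))"
    using s by (subst ln_le_cancel_iff) (auto simp: divide_right_mono)
  then have "ennreal (m * (4 * pi * ln (r / (2 * s)))) \<le> ennreal (m * (4 * pi * ln ((r + s) / (s + s))))"
    using \<open>m \<ge> 0\<close> by (intro ennreal_leI mult_left_mono) auto
  also have "\<dots> = ennreal m * integral\<^sup>N lborel C"
    unfolding C_def using nn_integral_log_shell[of s s r] s \<open>m \<ge> 0\<close> by (simp add: ennreal_mult')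
  also have "\<dots> = (\<integral>\<^sup>+y. ennreal m * ennreal (C y) \<partial>lborel)"
    by (subst nn_integral_cmult) auto
  also have "\<dots> \<le> (\<integral>\<^sup>+y. ennreal (f y / norm (y - x)) \<partial>lborel)"
  proof (rule nn_integral_mono_AE)
    show "AE y in lborel. ennreal m * ennreal (C y) \<le> ennreal (f y / norm (y - x))"
      using AE_lborel_singleton[of x]
    proof eventually_elim
      case (elim y)
      show ?case
      proof (cases "s \<le> norm y \<and> norm y \<le> r")
        case True
        have "norm (y - x) \<le> norm y + s" unfolding s_def by norm
        then have "m / (norm y)\<^sup>2 / (norm y + s) \<le> f y / norm (y - x)"
        proof (intro frac_le)
          show "m / (norm y)\<^sup>2 \<le> f y" using True s by (intro ge) auto
          then show "0 \<le> f y" using \<open>m \<ge> 0\<close> by (meson divide_nonneg_nonneg order_trans zero_le_power2)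
        qed (use elim in auto)
        then show ?thesis using True \<open>m \<ge> 0\<close>
          by (simp add: C_def ennreal_leI mult.commute flip: ennreal_mult')
      qed (simp add: C_def)
    qed
  qed
  finally show ?thesis by (simp add: s_def)
qed

text \<open>Inside the ball \<open>f\<close> is bounded and 1/|y - x| is integrable in dimension 3;
  outside it the kernel is at most 1/d and \<open>f\<close> is integrable.\<close>

lemma integrable_newton_potential:
  fixes f :: "real ^ 3 \<Rightarrow> real"
  assumes f: "integrable lborel f" "\<And>y. f y \<ge> 0" and "d > 0"
    and le: "\<And>y. y \<in> cball x d \<Longrightarrow> f y \<le> M"
  shows "integrable lborel (\<lambda>y. f y / norm (y - x))"
proof (rule Bochner_Integration.integrable_bound)
  have [measurable]: "f \<in> borel_measurable borel" using f(1) by auto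
  have "integrable lborel (\<lambda>y. 1 / norm (y - x) * indicator (cball x d) y)"
  proof (rule integrableI_nonneg)
    show "(\<lambda>y. 1 / norm (y - x) * indicator (cball x d) y) \<in> borel_measurable lborel"
      unfolding measurable_lborel2
      by (rule borel_measurable_inverse_norm_ball)
    show "(\<integral>\<^sup>+y. ennreal (1 / norm (y - x) * indicator (cball x d) y) \<partial>lborel) < \<infinity>"
      using nn_integral_inverse_norm_ball[of d x] \<open>d > 0\<close> by simp
  qed auto
  then show "integrable lborel (\<lambda>y. M * (1 / norm (y - x) * indicator (cball x d) y) + 1 / d * f y)"
    using f by (intro Bochner_Integration.integrable_add integrable_mult_right)
  show "(\<lambda>y. f y / norm (y - x)) \<in> borel_measurable lborel" by measurable
  show "AE y in lborel. norm (f y / norm (y - x)) \<le>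
      norm (M * (1 / norm (y - x) * indicator (cball x d) y) + 1 / d * f y)"
  proof (rule AE_I2)
    fix y
    have M: "M \<ge> 0" using le[of x] f(2)[of x] \<open>d > 0\<close> by auto
    have "f y / norm (y - x) \<le> M * (1 / norm (y - x) * indicator (cball x d) y) + 1 / d * f y"
    proof (cases "y \<in> cball x d")
      case True
      then have "f y * (1 / norm (y - x)) \<le> M * (1 / norm (y - x))"
        using le by (intro mult_right_mono) auto
      then show ?thesis using True f(2)[of y] \<open>d > 0\<close> by (simp add: add_increasing2)
    next
      case False
      then have "f y * (1 / norm (y - x)) \<le> f y * (1 / d)"
        using f(2)[of y] \<open>d > 0\<close>
        by (intro mult_left_mono) (auto simp: dist_norm norm_minus_commute frac_le)
      then show ?thesis using False by simp
    qed
    moreover have "0 \<le> f y / norm (y - x)" using f(2) by simp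
    ultimately show "norm (f y / norm (y - x)) \<le>
      norm (M * (1 / norm (y - x) * indicator (cball x d) y) + 1 / d * f y)"
      by simp
  qed
qed

subsection \<open>The regularised kernel as an approximate identity\<close>

text \<open>Minus the Laplacian of \<open>plummer_potential\<close>: 4 pi times the mass density of
  the Plummer model of unit mass.\<close>

definition plummer_density :: "real \<Rightarrow> real ^ 3 \<Rightarrow> real ^ 3 \<Rightarrow> real" where
  "plummer_density e x y = 3 * e * ((norm (y - x))\<^sup>2 + e) powr (- 5 / 2)"

lemma plummer_density_nonneg: "e \<ge> 0 \<Longrightarrow> 0 \<le> plummer_density e x y"
  by (simp add: plummer_density_def)

lemma borel_measurable_plummer_density [measurable]: "plummer_density e x \<in> borel_measurable borel"
  unfolding plummer_density_def[abs_def] by measurable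

lemma plummer_density_off_ball:
  assumes "e > 0" "d > 0" "norm (y - x) \<ge> d"
  shows "plummer_density e x y \<le> 3 * e / d ^ 5"
proof -
  have "plummer_density e x y \<le> 3 * e * (1 / d powr (2 * (5 / 2)))"
    unfolding plummer_density_def using shifted_norm_sq_powr_le[of e d y x "5 / 2"] assms
    by (intro mult_left_mono) auto
  then show ?thesis using assms by simp
qed

text \<open>The antiderivative comes from Gauss's theorem: the mass inside radius r is the flux 4 pi
  r^2 * r (r^2 + e)^(-3/2) of minus the gradient of the softened kernel through the sphere. For
  fixed \<open>d\<close> it tends to 4 pi as e tends to 0.\<close>

lemma has_bochner_integral_plummer_density_ball:
  assumes "e > 0" "d > 0"
  shows "has_bochner_integral lborel (\<lambda>y. plummer_density e x y * indicator (cball x d) y)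
     (4 * pi * d ^ 3 * (d\<^sup>2 + e) powr (- 3 / 2))"
proof (rule has_bochner_integral_nn_integral)
  let ?f = "\<lambda>r. 3 * e * (r\<^sup>2 + e) powr (- 5 / 2)"
  let ?D = "\<lambda>r. 4 * pi * r\<^sup>2 * ?f r"
  let ?F = "\<lambda>r. 4 * pi * r ^ 3 * (r\<^sup>2 + e) powr (- 3 / 2)"
  let ?I = "\<lambda>z::real^3. ennreal (?f (norm z) * indicator {z. 0 \<le> norm z \<and> norm z \<le> d} z)"
  have "(?F has_real_derivative ?D r) (at r)" for r
  proof -
    have pos: "r\<^sup>2 + e > 0" using \<open>e > 0\<close> by (simp add: add_nonneg_pos)
    have q: "(r\<^sup>2 + e) powr (- 3 / 2) = (r\<^sup>2 + e) * (r\<^sup>2 + e) powr (- 5 / 2)"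
      using powr_add[of "r\<^sup>2 + e" 1 "- 5 / 2"] pos by simp
    have p: "((\<lambda>r. (r\<^sup>2 + e) powr (- 3 / 2)) has_real_derivative - 3 * r * (r\<^sup>2 + e) powr (- 5 / 2)) (at r)"
      using pos by (auto intro!: derivative_eq_intros)
    have "(?F has_real_derivative (4 * pi * (3 * r\<^sup>2)) * (r\<^sup>2 + e) powr (- 3 / 2)
        + (- 3 * r * (r\<^sup>2 + e) powr (- 5 / 2)) * (4 * pi * r ^ 3)) (at r)"
      by (rule DERIV_mult[OF _ p]) (auto intro!: derivative_eq_intros)
    also have "(4 * pi * (3 * r\<^sup>2)) * (r\<^sup>2 + e) powr (- 3 / 2)
        + (- 3 * r * (r\<^sup>2 + e) powr (- 5 / 2)) * (4 * pi * r ^ 3) = ?D r"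
      unfolding q by (simp add: algebra_simps power2_eq_square power3_eq_cube)
    finally show ?thesis .
  qed
  then have "integral\<^sup>N lborel ?I = ennreal (?F d - ?F 0)"
    by (intro nn_integral_shell[where D = ?D]) (use assms in auto)
  moreover have "(\<integral>\<^sup>+y. ?I (y - x) \<partial>lborel) = integral\<^sup>N lborel ?I"
    by (rule nn_integral_lborel_translate) measurable
  moreover have "(\<integral>\<^sup>+y. ennreal (plummer_density e x y * indicator (cball x d) y) \<partial>lborel) = (\<integral>\<^sup>+y. ?I (y - x) \<partial>lborel)"
    by (intro nn_integral_cong)
       (auto simp: plummer_density_def dist_norm norm_minus_commute split: split_indicator)
  ultimately show "(\<integral>\<^sup>+y. ennreal (plummer_density e x y * indicator (cball x d) y) \<partial>lborel)
      = ennreal (4 * pi * d ^ 3 * (d\<^sup>2 + e) powr (- 3 / 2))" by simp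
  show "(\<lambda>y. plummer_density e x y * indicator (cball x d) y) \<in> borel_measurable lborel"
    unfolding measurable_lborel2
    by (intro borel_measurable_times borel_measurable_indicator) (auto simp: borel_measurable_plummer_density)
qed (use assms in \<open>auto simp: plummer_density_nonneg\<close>)

text \<open>The integrand is compared with g(x) times the density restricted to a small ball.
  Inside, continuity at \<open>x\<close> controls the difference; outside, the density is O(e)
  uniformly, so the integral of |g| suffices there.\<close>

lemma plummer_density_concentrates:
  assumes g: "integrable lborel g" and cont: "isCont g x"
  shows "((\<lambda>e. \<integral>y. g y * plummer_density e x y \<partial>lborel) \<longlongrightarrow> 4 * pi * g x) (at_right 0)"
proof (rule tendstoI)
  fix \<epsilon> :: real assume "\<epsilon> > 0"
  \<comment> \<open>The ball has mass tending to 4 pi, so the error inside it tends to 4 pi \<gamma>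
    = \<epsilon>/2.\<close>
  define \<gamma> where "\<gamma> = \<epsilon> / (8 * pi)"
  have "\<gamma> > 0" using \<open>\<epsilon> > 0\<close> by (simp add: \<gamma>_def)
  then obtain d' where d': "d' > 0" "\<And>y. dist y x < d' \<Longrightarrow> dist (g y) (g x) < \<gamma>"
    using cont unfolding continuous_at_eps_delta by blast
  define d where "d = d' / 2"
  have d: "d > 0" "\<And>y. y \<in> cball x d \<Longrightarrow> \<bar>g y - g x\<bar> \<le> \<gamma>"
    using d' by (auto simp: d_def dist_commute dist_real_def intro!: less_imp_le)
  have [measurable]: "g \<in> borel_measurable borel" using g by auto
  define m where "m = (\<lambda>e. 4 * pi * d ^ 3 * (d\<^sup>2 + e) powr (- 3 / 2))"
  let ?P = "\<lambda>e y. plummer_density e x y * indicator (cball x d) y"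
  have bound: "\<bar>(\<integral>y. g y * plummer_density e x y \<partial>lborel) - 4 * pi * g x\<bar>
      \<le> \<gamma> * m e + 3 * e / d ^ 5 * (\<integral>y. \<bar>g y\<bar> \<partial>lborel) + \<bar>g x\<bar> * \<bar>m e - 4 * pi\<bar>" if "e > 0" for e
  proof -
    note P = has_bochner_integral_plummer_density_ball[OF that d(1), of x, folded m_def]
    then have iP: "integrable lborel (?P e)" "integral\<^sup>L lborel (?P e) = m e"
      by (auto simp: has_bochner_integral_iff m_def)
    let ?u = "\<lambda>y. \<gamma> * ?P e y + 3 * e / d ^ 5 * \<bar>g y\<bar>"
    have iu: "integrable lborel ?u"
      using iP g by (intro Bochner_Integration.integrable_add integrable_mult_right integrable_abs)
    have le: "\<bar>g y * plummer_density e x y - g x * ?P e y\<bar> \<le> ?u y" for y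
    proof (cases "y \<in> cball x d")
      case True
      have "\<bar>g y - g x\<bar> * plummer_density e x y \<le> \<gamma> * plummer_density e x y"
        using d(2)[OF True] that by (intro mult_right_mono) (auto simp: plummer_density_nonneg)
      moreover have "\<bar>g y * plummer_density e x y - g x * ?P e y\<bar> = \<bar>g y - g x\<bar> * plummer_density e x y"
        using True that by (simp add: plummer_density_nonneg abs_mult flip: left_diff_distrib)
      ultimately show ?thesis using True that d by (simp add: add_increasing2)
    next
      case False
      then have "plummer_density e x y * \<bar>g y\<bar> \<le> 3 * e / d ^ 5 * \<bar>g y\<bar>"
        using that d by (intro mult_right_mono plummer_density_off_ball) (auto simp: dist_norm norm_minus_commute)
      then show ?thesis using False that by (simp add: abs_mult plummer_density_nonneg mult.commute)
    qed
    have idiff: "integrable lborel (\<lambda>y. g y * plummer_density e x y - g x * ?P e y)"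
    proof (rule Bochner_Integration.integrable_bound[OF iu])
      show "(\<lambda>y. g y * plummer_density e x y - g x * ?P e y) \<in> borel_measurable lborel"
        by (intro borel_measurable_diff
            borel_measurable_times[OF borel_measurable_const borel_measurable_integrable[OF iP(1)]]) measurable
      show "AE y in lborel. norm (g y * plummer_density e x y - g x * ?P e y) \<le> norm (?u y)"
        unfolding real_norm_def by (intro AE_I2 order_trans[OF le abs_ge_self])
    qed
    have igP: "integrable lborel (\<lambda>y. g y * plummer_density e x y)"
      using Bochner_Integration.integrable_add[OF idiff integrable_mult_right[OF iP(1), of "g x"]] by simp
    have "\<bar>(\<integral>y. g y * plummer_density e x y \<partial>lborel) - g x * m e\<bar>
        = \<bar>\<integral>y. g y * plummer_density e x y - g x * ?P e y \<partial>lborel\<bar>"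
      using igP iP by (simp add: Bochner_Integration.integral_diff)
    also have "\<dots> \<le> (\<integral>y. ?u y \<partial>lborel)"
      using idiff iu le by (rule integral_abs_bound_integral)
    also have "\<dots> = \<gamma> * m e + 3 * e / d ^ 5 * (\<integral>y. \<bar>g y\<bar> \<partial>lborel)"
      using iP g by (simp add: Bochner_Integration.integral_add)
    finally have "\<bar>(\<integral>y. g y * plummer_density e x y \<partial>lborel) - g x * m e\<bar>
      \<le> \<gamma> * m e + 3 * e / d ^ 5 * (\<integral>y. \<bar>g y\<bar> \<partial>lborel)" .
    moreover have "\<bar>g x * m e - 4 * pi * g x\<bar> = \<bar>g x\<bar> * \<bar>m e - 4 * pi\<bar>"
      by (simp add: algebra_simps flip: abs_mult)
    ultimately show ?thesis by linarith
  qed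
  have "((\<lambda>e. d\<^sup>2 + e) \<longlongrightarrow> d\<^sup>2 + 0) (at_right 0)" by (intro tendsto_intros)
  then have "(m \<longlongrightarrow> 4 * pi * d ^ 3 * (d\<^sup>2 + 0) powr (- 3 / 2)) (at_right 0)"
    unfolding m_def using d(1) by (intro tendsto_intros) auto
  moreover have "(d\<^sup>2) powr (- 3 / 2) = 1 / d ^ 3"
    using d(1) by (simp add: powr_powr powr_minus_divide flip: powr_numeral)
  ultimately have m: "(m \<longlongrightarrow> 4 * pi) (at_right 0)" using d(1) by simp
  have "((\<lambda>e. \<gamma> * m e + 3 * e / d ^ 5 * (\<integral>y. \<bar>g y\<bar> \<partial>lborel) + \<bar>g x\<bar> * \<bar>m e - 4 * pi\<bar>)
      \<longlongrightarrow> \<gamma> * (4 * pi) + 3 * 0 / d ^ 5 * (\<integral>y. \<bar>g y\<bar> \<partial>lborel) + \<bar>g x\<bar> * \<bar>4 * pi - 4 * pi\<bar>) (at_right 0)"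
    using d(1) by (intro tendsto_intros m) auto
  then have "((\<lambda>e. \<gamma> * m e + 3 * e / d ^ 5 * (\<integral>y. \<bar>g y\<bar> \<partial>lborel) + \<bar>g x\<bar> * \<bar>m e - 4 * pi\<bar>)
      \<longlongrightarrow> \<epsilon> / 2) (at_right 0)" by (simp add: \<gamma>_def)
  then have "\<forall>\<^sub>F e in at_right 0. \<gamma> * m e + 3 * e / d ^ 5 * (\<integral>y. \<bar>g y\<bar> \<partial>lborel) + \<bar>g x\<bar> * \<bar>m e - 4 * pi\<bar> < \<epsilon>"
    by (rule order_tendstoD) (use \<open>\<epsilon> > 0\<close> in auto)
  moreover have "\<forall>\<^sub>F e in at_right 0. (e::real) > 0" by (simp add: eventually_at_right_less)
  ultimately show "\<forall>\<^sub>F e in at_right 0. dist (\<integral>y. g y * plummer_density e x y \<partial>lborel) (4 * pi * g x) < \<epsilon>"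
    by eventually_elim (use bound in \<open>fastforce simp: dist_real_def\<close>)
qed

lemma plummer_potential_tendsto:
  assumes "y \<noteq> x"
  shows "((\<lambda>e. plummer_potential e x y) \<longlongrightarrow> 1 / norm (y - x)) (at_right 0)"
proof -
  have "((\<lambda>e. 1 / sqrt ((norm (y - x))\<^sup>2 + e)) \<longlongrightarrow> 1 / sqrt ((norm (y - x))\<^sup>2 + 0)) (at_right 0)"
    using assms by (intro tendsto_intros) auto
  then have "((\<lambda>e. 1 / sqrt ((norm (y - x))\<^sup>2 + e)) \<longlongrightarrow> 1 / norm (y - x)) (at_right 0)"
    by simp
  then show ?thesis
    by (rule Lim_transform_eventually) (auto simp: plummer_potential_eq eventually_at_filter)
qed

subsection \<open>Representation of positive solutions\<close>

lemma continuous_bounded_on_cball: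
  fixes f :: "'a::euclidean_space \<Rightarrow> real"
  assumes "continuous_on (cball a r) f"
  obtains B where "B \<ge> 0" "\<And>y. y \<in> cball a r \<Longrightarrow> \<bar>f y\<bar> \<le> B"
proof -
  have "bounded (f ` cball a r)"
    using assms by (intro compact_imp_bounded compact_continuous_image) auto
  then obtain B where "B > 0" "\<And>z. z \<in> f ` cball a r \<Longrightarrow> norm z \<le> B"
    unfolding bounded_pos by blast
  then show ?thesis by (intro that[of B]) auto
qed

text \<open>In the product rule the term with the Laplacian of the kernel cancels against the
  density. The others carry a derivative of the cutoff, so they live on 1 <= |y| <= 2, where 1/2 <=
  |y - x| <= 5/2. Hence one \<open>C\<close> serves all e and x.\<close>

lemma cutoff_laplacian_defect:
  fixes \<eta> :: "real ^ 3 \<Rightarrow> real"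
  assumes \<eta>: "smooth \<eta>" "\<And>y. norm y < 1 \<Longrightarrow> \<eta> y = 1" "\<And>y. norm y \<ge> 2 \<Longrightarrow> \<eta> y = 0"
  obtains C where "C \<ge> 0"
    "\<And>e x y. e > 0 \<Longrightarrow> norm x < 1 / 2 \<Longrightarrow>
       \<bar>laplacian (\<lambda>y. \<eta> y * plummer_potential e x y) y + \<eta> y * plummer_density e x y\<bar> \<le> C * indicator (cball 0 2) y"
proof -
  have "\<forall>b. \<exists>B\<ge>0. \<forall>y\<in>cball 0 2. \<bar>partial_deriv b \<eta> y\<bar> \<le> B"
    using continuous_bounded_on_cball[OF smooth_continuous[OF smooth_partial_deriv[OF \<eta>(1)]]] by metis
  then obtain B where B: "\<And>b. B b \<ge> 0" "\<And>b y. y \<in> cball 0 2 \<Longrightarrow> \<bar>partial_deriv b \<eta> y\<bar> \<le> B b"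
    by metis
  obtain L where L: "L \<ge> 0" "\<And>y. y \<in> cball 0 2 \<Longrightarrow> \<bar>laplacian \<eta> y\<bar> \<le> L"
    using continuous_bounded_on_cball[OF smooth_continuous[OF smooth_laplacian[OF \<eta>(1)]]] by metis
  \<comment> \<open>On the shell the kernel is at most 1/(1/2) = 2, and each partial derivative of
    it at most (1/2)^(-3) * 5/2 = 20.\<close>
  define C where "C = L * 2 + 2 * (\<Sum>b\<in>Basis. B b * 20)"
  show ?thesis
  proof
    show "C \<ge> 0" using L B unfolding C_def by (intro add_nonneg_nonneg mult_nonneg_nonneg sum_nonneg) auto
    fix e :: real and x y :: "real ^ 3"
    assume e: "e > 0" and x: "norm x < 1 / 2"
    have eq: "laplacian (\<lambda>y. \<eta> y * plummer_potential e x y) y + \<eta> y * plummer_density e x y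
       = laplacian \<eta> y * plummer_potential e x y + 2 * (\<Sum>b\<in>Basis. partial_deriv b \<eta> y * partial_deriv b (plummer_potential e x) y)"
      using laplacian_mult[OF \<eta>(1) smooth_plummer_potential[OF e], of x y]
      by (simp add: laplacian_plummer_potential[OF e] plummer_density_def)
    consider "norm y < 1" | "norm y > 2" | "1 \<le> norm y" "norm y \<le> 2" by linarith
    then show "\<bar>laplacian (\<lambda>y. \<eta> y * plummer_potential e x y) y + \<eta> y * plummer_density e x y\<bar> \<le> C * indicator (cball 0 2) y"
    proof cases
      case 1
      have "laplacian \<eta> y = 0" "\<And>b. partial_deriv b \<eta> y = 0"
        using laplacian_locally_const[of "ball 0 1" \<eta> 1 y] partial_deriv_locally_const[of "ball 0 1" \<eta> 1 y] \<eta>(2) 1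
        by auto
      then show ?thesis unfolding eq using \<open>C \<ge> 0\<close> by simp
    next
      case 2
      have "open (- cball (0::real^3) 2)" by auto
      then have "laplacian \<eta> y = 0" "\<And>b. partial_deriv b \<eta> y = 0"
        using laplacian_locally_const[of "- cball 0 2" \<eta> 0 y] partial_deriv_locally_const[of "- cball 0 2" \<eta> 0 y] \<eta>(3) 2
        by auto
      then show ?thesis unfolding eq using \<open>C \<ge> 0\<close> by simp
    next
      case 3
      then have y: "y \<in> cball 0 2" by simp
      have d: "norm (y - x) \<ge> 1 / 2" "norm (y - x) \<le> 5 / 2"
        using norm_triangle_ineq2[of y x] norm_triangle_ineq4[of y x] 3 x by auto
      have "plummer_potential e x y \<le> 1 / norm (y - x)" using d e by (intro plummer_potential_le) auto
      also have "\<dots> \<le> 2" using frac_le[of 1 1 "1 / 2" "norm (y - x)"] d(1) by simp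
      finally have G: "\<bar>plummer_potential e x y\<bar> \<le> 2" by (simp add: plummer_potential_nonneg)
      have dG: "\<bar>partial_deriv b (plummer_potential e x) y\<bar> \<le> 20" if "b \<in> Basis" for b
      proof -
        have "((norm (y - x))\<^sup>2 + e) powr (- (3 / 2)) \<le> 1 / (1 / 2) powr (2 * (3 / 2))"
          using e d by (intro shifted_norm_sq_powr_le) auto
        also have "\<dots> = 8" by (simp add: powr_numeral power3_eq_cube)
        finally have "((norm (y - x))\<^sup>2 + e) powr (- 3 / 2) \<le> 8" by simp
        moreover have "\<bar>(y - x) \<bullet> b\<bar> \<le> 5 / 2"
          using Basis_le_norm[OF that, of "y - x"] d by linarith
        ultimately have "((norm (y - x))\<^sup>2 + e) powr (- 3 / 2) * \<bar>(y - x) \<bullet> b\<bar> \<le> 8 * (5 / 2)"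
          by (intro mult_mono) auto
        then show ?thesis unfolding partial_deriv_plummer_potential[OF e] by (simp add: abs_mult)
      qed
      have "\<bar>laplacian \<eta> y * plummer_potential e x y + 2 * (\<Sum>b\<in>Basis. partial_deriv b \<eta> y * partial_deriv b (plummer_potential e x) y)\<bar>
        \<le> \<bar>laplacian \<eta> y\<bar> * \<bar>plummer_potential e x y\<bar> + 2 * (\<Sum>b\<in>Basis. \<bar>partial_deriv b \<eta> y\<bar> * \<bar>partial_deriv b (plummer_potential e x) y\<bar>)"
        using sum_abs[of "\<lambda>b. partial_deriv b \<eta> y * partial_deriv b (plummer_potential e x) y" Basis]
        by (simp only: abs_mult[symmetric])
      also have "\<dots> \<le> C" unfolding C_def
        by (intro add_mono mult_left_mono mult_mono sum_mono L B G dG y) auto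
      finally show ?thesis unfolding eq using y by simp
    qed
  qed
qed

lemma plummer_potential_cutoff_test_fun:
  assumes "smooth \<eta>" "\<And>y. norm y \<ge> 2 \<Longrightarrow> \<eta> y = 0" "e > 0"
  shows "test_fun (\<lambda>y. \<eta> y * plummer_potential e x y)"
proof -
  have "{y. \<eta> y * plummer_potential e x y \<noteq> 0} \<subseteq> cball 0 2"
    using assms(2) by (force simp: not_le)
  then have "bounded {y. \<eta> y * plummer_potential e x y \<noteq> 0}"
    using bounded_cball bounded_subset by blast
  then show ?thesis
    unfolding test_fun_def using assms
    by (auto simp: compact_closure intro: smooth_C_k smooth_mult smooth_plummer_potential)
qed

text \<open>Here \<open>f\<close> is the cutoff times V^2. The weak equation is used doubled, so the
  point mass contributes 2 l times the kernel at 0, while the density contributes 4 pi V(x) in the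
  limit; their quotient is the coefficient l / (2 pi).\<close>

lemma positive_solution_representation:
  assumes "l > 0" "positive_solution l V"
  obtains f C where "integrable lborel f" "\<And>y. f y \<ge> 0" "\<And>y. norm y < 1 \<Longrightarrow> f y = (V y)\<^sup>2"
    "\<And>x. x \<noteq> 0 \<Longrightarrow> norm x < 1 / 2 \<Longrightarrow> integrable lborel (\<lambda>y. f y / norm (y - x))"
    "\<And>x. x \<noteq> 0 \<Longrightarrow> norm x < 1 / 2 \<Longrightarrow>
       \<bar>4 * pi * V x - 2 * l / norm x + (\<integral>y. f y / norm (y - x) \<partial>lborel)\<bar> \<le> C"
proof -
  obtain \<eta> :: "real ^ 3 \<Rightarrow> real" where \<eta>: "smooth \<eta>" "\<And>y. 0 \<le> \<eta> y" "\<And>y. \<eta> y \<le> 1"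
    "\<And>y. norm y < 1 \<Longrightarrow> \<eta> y = 1" "\<And>y. norm y \<ge> 2 \<Longrightarrow> \<eta> y = 0"
    using cutoff_exists by blast
  obtain C where C: "C \<ge> 0" "\<And>e x y. e > 0 \<Longrightarrow> norm x < 1 / 2 \<Longrightarrow>
       \<bar>laplacian (\<lambda>y. \<eta> y * plummer_potential e x y) y + \<eta> y * plummer_density e x y\<bar> \<le> C * indicator (cball 0 2) y"
    using cutoff_laplacian_defect[OF \<eta>(1,4,5)] by blast
  have cont: "continuous_on (UNIV - {0}) V"
    and weak: "\<And>\<phi>. test_fun \<phi> \<Longrightarrow> (LINT x|lborel. V x * (laplacian \<phi> x / 2)) =
        (LINT x|lborel. (V x)\<^sup>2 / 2 * \<phi> x) - l * \<phi> 0"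
    and "locally_integrable V" "locally_integrable (\<lambda>x. (V x)\<^sup>2)"
    using assms(2) unfolding positive_solution_def by auto
  then have intV: "integrable lborel (\<lambda>y. indicator (cball 0 2) y * V y)"
    and intV2: "integrable lborel (\<lambda>y. indicator (cball 0 2) y * (V y)\<^sup>2)"
    unfolding locally_integrable_def set_integrable_def by simp_all
  have [measurable]: "\<eta> \<in> borel_measurable borel"
    using smooth_continuous[OF \<eta>(1)] by (rule borel_measurable_continuous_onI)
  have cut: "\<eta> y = indicator (cball 0 2) y * \<eta> y" for y
    using \<eta>(5)[of y] by (auto split: split_indicator)
  define g where "g = (\<lambda>y. \<eta> y * V y)"
  define f where "f = (\<lambda>y. \<eta> y * (V y)\<^sup>2)"
  \<comment> \<open>Measurability of \<open>h\<close> is drawn from its integrability on the ball,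
    so the indicator is inserted first and absorbed into \<eta> afterwards.\<close>
  have cut_int: "integrable lborel (\<lambda>y. \<eta> y * h y)" if h: "integrable lborel (\<lambda>y. indicator (cball 0 2) y * h y)"
    for h :: "real^3 \<Rightarrow> real"
  proof -
    have "integrable lborel (\<lambda>y. \<eta> y * (indicator (cball 0 2) y * h y))"
    proof (rule Bochner_Integration.integrable_bound[OF h])
      show "(\<lambda>y. \<eta> y * (indicator (cball 0 2) y * h y)) \<in> borel_measurable lborel"
        by (intro borel_measurable_times borel_measurable_integrable[OF h]) measurable
      show "AE y in lborel. norm (\<eta> y * (indicator (cball 0 2) y * h y)) \<le> norm (indicator (cball 0 2) y * h y)"
        using mult_right_mono[OF \<eta>(3)] \<eta>(2) by (intro AE_I2) (simp add: abs_mult mult_left_le_one_le)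
    qed
    moreover have "\<eta> y * (indicator (cball 0 2) y * h y) = \<eta> y * h y" for y
      using cut[of y] by (metis mult.assoc mult.commute)
    ultimately show ?thesis by simp
  qed
  have g: "integrable lborel g" unfolding g_def using intV by (rule cut_int)
  have f: "integrable lborel f" unfolding f_def using intV2 by (rule cut_int)
  have f0: "f y \<ge> 0" for y using \<eta>(2) by (simp add: f_def)
  have contV: "isCont V x" if "x \<noteq> 0" for x
    using cont that by (simp add: continuous_on_eq_continuous_at open_delete)
  have contE: "isCont \<eta> x" for x
    using smooth_continuous[OF \<eta>(1), of UNIV] by (simp add: continuous_on_eq_continuous_at)
  define K where "K = C * (\<integral>y. \<bar>indicator (cball 0 2) y * V y\<bar> \<partial>lborel)"
  have identity: "\<bar>(\<integral>y. g y * plummer_density e x y \<partial>lborel) + (\<integral>y. f y * plummer_potential e x y \<partial>lborel)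
      - 2 * l * plummer_potential e x 0\<bar> \<le> K" if e: "e > 0" and x: "norm x < 1 / 2" for e x
  proof -
    let ?\<phi> = "\<lambda>y. \<eta> y * plummer_potential e x y"
    let ?R = "\<lambda>y. V y * (laplacian ?\<phi> y + \<eta> y * plummer_density e x y)"
    have test: "test_fun ?\<phi>" using \<eta>(1,5) e by (rule plummer_potential_cutoff_test_fun)
    have R_le: "\<bar>?R y\<bar> \<le> C * \<bar>indicator (cball 0 2) y * V y\<bar>" for y
    proof -
      have "\<bar>V y\<bar> * \<bar>laplacian ?\<phi> y + \<eta> y * plummer_density e x y\<bar> \<le> \<bar>V y\<bar> * (C * indicator (cball 0 2) y)"
        using C(2)[OF e x] by (intro mult_left_mono) auto
      then show ?thesis by (simp add: abs_mult mult_ac)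
    qed
    have [measurable]: "laplacian ?\<phi> \<in> borel_measurable borel"
      by (intro borel_measurable_continuous_onI smooth_continuous smooth_laplacian smooth_mult \<eta> smooth_plummer_potential e)
    \<comment> \<open>Off the ball \<open>R_le\<close> forces \<open>?R y\<close> to vanish, so the
      indicator may be inserted; measurability then follows as before.\<close>
    have R_cut: "?R y = (indicator (cball 0 2) y * V y) * (laplacian ?\<phi> y + \<eta> y * plummer_density e x y)" for y
      using R_le[of y] by (auto split: split_indicator)
    have iR: "integrable lborel ?R"
    proof (rule Bochner_Integration.integrable_bound)
      show "integrable lborel (\<lambda>y. C * \<bar>indicator (cball 0 2) y * V y\<bar>)"
        using intV by (intro integrable_mult_right integrable_abs)
      show "?R \<in> borel_measurable lborel"
        unfolding R_cut by (intro borel_measurable_times borel_measurable_integrable[OF intV]) measurable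
      show "AE y in lborel. norm (?R y) \<le> norm (C * \<bar>indicator (cball 0 2) y * V y\<bar>)"
        unfolding real_norm_def by (intro AE_I2 order_trans[OF R_le abs_ge_self])
    qed
    have iP: "integrable lborel (\<lambda>y. g y * plummer_density e x y)"
    proof (rule Bochner_Integration.integrable_bound)
      \<comment> \<open>The value of the density at its peak y = x. It blows up as e tends to 0, but
        serves only to split the integral for fixed e.\<close>
      let ?c = "3 * e * e powr (- 5 / 2)"
      show "integrable lborel (\<lambda>y. ?c * g y)" using g by (rule integrable_mult_right)
      show "(\<lambda>y. g y * plummer_density e x y) \<in> borel_measurable lborel"
        using g by (intro borel_measurable_times) auto
      show "AE y in lborel. norm (g y * plummer_density e x y) \<le> norm (?c * g y)"
      proof (rule AE_I2)
        fix y
        have "((norm (y - x))\<^sup>2 + e) powr (- 5 / 2) \<le> e powr (- 5 / 2)"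
          using e by (intro powr_mono2') auto
        then have "plummer_density e x y \<le> ?c" using e by (simp add: plummer_density_def)
        then have "plummer_density e x y * \<bar>g y\<bar> \<le> ?c * \<bar>g y\<bar>" by (intro mult_right_mono) auto
        then show "norm (g y * plummer_density e x y) \<le> norm (?c * g y)"
          using e by (simp add: abs_mult plummer_density_nonneg mult_ac)
      qed
    qed
    \<comment> \<open>Removing the density term from \<open>?R\<close> leaves V times the Laplacian
      of the test function, to which the weak equation applies.\<close>
    have "(\<integral>y. ?R y \<partial>lborel) - (\<integral>y. g y * plummer_density e x y \<partial>lborel)
        = (\<integral>y. ?R y - g y * plummer_density e x y \<partial>lborel)"
      using iR iP by simp
    also have "\<dots> = (\<integral>y. 2 * (V y * (laplacian ?\<phi> y / 2)) \<partial>lborel)"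
      by (intro Bochner_Integration.integral_cong) (auto simp: g_def algebra_simps)
    also have "\<dots> = 2 * ((\<integral>y. (V y)\<^sup>2 / 2 * ?\<phi> y \<partial>lborel) - l * ?\<phi> 0)"
      by (simp only: integral_mult_right_zero weak[OF test])
    also have "\<dots> = (\<integral>y. f y * plummer_potential e x y \<partial>lborel) - 2 * l * plummer_potential e x 0"
    proof -
      have "(\<integral>y. (V y)\<^sup>2 / 2 * ?\<phi> y \<partial>lborel) = (\<integral>y. 1 / 2 * (f y * plummer_potential e x y) \<partial>lborel)"
        by (intro Bochner_Integration.integral_cong) (auto simp: f_def)
      also have "\<dots> = 1 / 2 * (\<integral>y. f y * plummer_potential e x y \<partial>lborel)"
        by (simp only: integral_mult_right_zero)
      finally show ?thesis using \<eta>(4)[of 0] by simp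
    qed
    finally have eq: "(\<integral>y. g y * plummer_density e x y \<partial>lborel) + (\<integral>y. f y * plummer_potential e x y \<partial>lborel)
      - 2 * l * plummer_potential e x 0 = (\<integral>y. ?R y \<partial>lborel)" by simp
    have "\<bar>\<integral>y. ?R y \<partial>lborel\<bar> \<le> (\<integral>y. C * \<bar>indicator (cball 0 2) y * V y\<bar> \<partial>lborel)"
      using iR _ R_le by (rule integral_abs_bound_integral) (use intV in \<open>intro integrable_mult_right integrable_abs\<close>)
    also have "\<dots> = K" by (simp only: K_def integral_mult_right_zero)
    finally show ?thesis unfolding eq .
  qed
  \<comment> \<open>The ball of radius |x|/2 about \<open>x\<close> avoids the origin, so
    \<open>f\<close> is continuous, hence bounded, on it.\<close>
  have pot: "integrable lborel (\<lambda>y. f y / norm (y - x))" if x: "x \<noteq> 0" for x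
  proof -
    have "y \<noteq> 0" if "y \<in> cball x (norm x / 2)" for y
      using that x by (auto simp: dist_norm)
    then have "continuous_on (cball x (norm x / 2)) f"
      unfolding f_def by (intro continuous_at_imp_continuous_on ballI continuous_intros contE contV)
    then obtain B where "\<And>y. y \<in> cball x (norm x / 2) \<Longrightarrow> \<bar>f y\<bar> \<le> B"
      using continuous_bounded_on_cball by blast
    then have "\<And>y. y \<in> cball x (norm x / 2) \<Longrightarrow> f y \<le> B" by (meson abs_le_D1)
    then show ?thesis using x by (intro integrable_newton_potential[OF f f0, of "norm x / 2" x B]) auto
  qed
  have limit: "\<bar>4 * pi * V x - 2 * l / norm x + (\<integral>y. f y / norm (y - x) \<partial>lborel)\<bar> \<le> K"
    if x: "x \<noteq> 0" "norm x < 1 / 2" for x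
  proof -
    have "isCont g x" unfolding g_def using x by (intro continuous_intros contE contV)
    then have "((\<lambda>e. \<integral>y. g y * plummer_density e x y \<partial>lborel) \<longlongrightarrow> 4 * pi * g x) (at_right 0)"
      using g by (intro plummer_density_concentrates)
    then have 1: "((\<lambda>e. \<integral>y. g y * plummer_density e x y \<partial>lborel) \<longlongrightarrow> 4 * pi * V x) (at_right 0)"
      using \<eta>(4)[of x] x by (simp add: g_def)
    have 2: "((\<lambda>e. plummer_potential e x 0) \<longlongrightarrow> 1 / norm x) (at_right 0)"
      using plummer_potential_tendsto[of 0 x] x by simp
    have 3: "((\<lambda>e. \<integral>y. f y * plummer_potential e x y \<partial>lborel) \<longlongrightarrow> (\<integral>y. f y / norm (y - x) \<partial>lborel)) (at_right 0)"
    proof (rule tendsto_at_right_sequentially[where b = 1])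
      fix S :: "nat \<Rightarrow> real"
      assume S: "\<And>n. 0 < S n" "S \<longlonglongrightarrow> 0"
      have S': "filterlim S (at_right 0) sequentially"
        using S(2) less_imp_neq[OF S(1)] S(1) by (auto simp: filterlim_at)
      show "(\<lambda>n. \<integral>y. f y * plummer_potential (S n) x y \<partial>lborel) \<longlonglongrightarrow> (\<integral>y. f y / norm (y - x) \<partial>lborel)"
      \<comment> \<open>The limit is its own dominating function: softening only lowers the
        kernel.\<close>
      proof (rule integral_dominated_convergence[where w = "\<lambda>y. f y / norm (y - x)"])
        show "(\<lambda>y. f y / norm (y - x)) \<in> borel_measurable lborel" using pot[OF x(1)] by auto
        show "(\<lambda>y. f y * plummer_potential (S n) x y) \<in> borel_measurable lborel" for n
          using f S smooth_continuous[OF smooth_plummer_potential[OF S(1)[of n]], of UNIV x]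
          by (intro borel_measurable_times) (auto intro: borel_measurable_continuous_onI)
        show "AE y in lborel. (\<lambda>n. f y * plummer_potential (S n) x y) \<longlonglongrightarrow> f y / norm (y - x)"
          using AE_lborel_singleton[of x]
        proof eventually_elim
          case (elim y)
          show ?case
            using tendsto_mult_left[OF filterlim_compose[OF plummer_potential_tendsto S'], of y x "f y"] elim by simp
        qed
        show "AE y in lborel. norm (f y * plummer_potential (S n) x y) \<le> f y / norm (y - x)" for n
          using AE_lborel_singleton[of x]
        proof eventually_elim
          case (elim y)
          have "f y * plummer_potential (S n) x y \<le> f y * (1 / norm (y - x))"
            using elim S(1)[of n] f0 by (intro mult_left_mono plummer_potential_le) auto
          then show ?case using f0[of y] by (simp add: abs_mult plummer_potential_nonneg)
        qed
      qed (rule pot[OF x(1)])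
    qed simp
    have "((\<lambda>e. \<bar>(\<integral>y. g y * plummer_density e x y \<partial>lborel) + (\<integral>y. f y * plummer_potential e x y \<partial>lborel)
      - 2 * l * plummer_potential e x 0\<bar>) \<longlongrightarrow> \<bar>4 * pi * V x + (\<integral>y. f y / norm (y - x) \<partial>lborel) - 2 * l * (1 / norm x)\<bar>) (at_right 0)"
      by (intro tendsto_intros 1 2 3)
    moreover have "\<forall>\<^sub>F e in at_right 0. \<bar>(\<integral>y. g y * plummer_density e x y \<partial>lborel) + (\<integral>y. f y * plummer_potential e x y \<partial>lborel)
      - 2 * l * plummer_potential e x 0\<bar> \<le> K"
      using identity x by (auto simp: eventually_at_filter)
    ultimately have "\<bar>4 * pi * V x + (\<integral>y. f y / norm (y - x) \<partial>lborel) - 2 * l * (1 / norm x)\<bar> \<le> K"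
      by (rule tendsto_upperbound) simp
    then show ?thesis by (simp add: algebra_simps)
  qed
  show ?thesis
    by (rule that[of f K]) (use f f0 pot limit \<eta>(4) in \<open>auto simp: f_def\<close>)
qed

subsection \<open>Logarithmic asymptotics\<close>

lemma filterlim_norm_at_right_0: "filterlim norm (at_right 0) (at (0::'a::real_normed_vector))"
  unfolding filterlim_at by (auto intro!: tendsto_eq_intros simp: eventually_at_filter)

lemma filterlim_ln_inverse_norm: "filterlim (\<lambda>x::'a::real_normed_vector. ln (1 / norm x)) at_top (at 0)"
proof -
  have "filterlim (\<lambda>t::real. ln (1 / t)) at_top (at_right 0)" by real_asymp
  then show ?thesis by (rule filterlim_compose[OF _ filterlim_norm_at_right_0])
qed

lemma eventually_at_0_norm:
  assumes "r > 0"
  shows "\<forall>\<^sub>F x in at (0::'a::real_normed_vector). x \<noteq> 0 \<and> norm x < r"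
  using assms by (auto simp: eventually_at)

lemma newton_potential_le:
  fixes f :: "real ^ 3 \<Rightarrow> real"
  assumes f: "integrable lborel f" "\<And>y. f y \<ge> 0" and "M \<ge> 0" "0 < r" "r \<le> 1"
    and le: "\<And>y. y \<noteq> 0 \<Longrightarrow> norm y \<le> r \<Longrightarrow> f y \<le> M / (norm y)\<^sup>2"
    and x: "x \<noteq> 0" "norm x < r / 2" and W: "integrable lborel (\<lambda>y. f y / norm (y - x))"
  shows "(\<integral>y. f y / norm (y - x) \<partial>lborel) \<le> 2 / r * integral\<^sup>L lborel f + M * (76 * pi + 4 * pi * ln (1 / norm x))"
proof -
  have "ennreal (\<integral>y. f y / norm (y - x) \<partial>lborel) = (\<integral>\<^sup>+y. ennreal (f y / norm (y - x)) \<partial>lborel)"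
    by (rule nn_integral_eq_integral[symmetric]) (use W f(2) in auto)
  also have "\<dots> \<le> ennreal (2 / r * integral\<^sup>L lborel f + M * (76 * pi + 4 * pi * ln (1 / norm x)))"
    using assms by (intro newton_potential_upper) auto
  finally show ?thesis
  proof (subst (asm) ennreal_le_iff)
    \<comment> \<open>The comparison in \<open>ennreal\<close> transfers back to the reals only for
      a nonnegative bound, since \<open>ennreal\<close> sends negative reals to 0.\<close>
    have "0 \<le> ln (1 / norm x)" using x \<open>r \<le> 1\<close> by (intro ln_ge_zero) auto
    then show "0 \<le> 2 / r * integral\<^sup>L lborel f + M * (76 * pi + 4 * pi * ln (1 / norm x))"
      using f \<open>M \<ge> 0\<close> \<open>0 < r\<close> by (intro add_nonneg_nonneg mult_nonneg_nonneg integral_nonneg_AE) auto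
  qed
qed

lemma newton_potential_ge:
  fixes f :: "real ^ 3 \<Rightarrow> real"
  assumes f: "integrable lborel f" "\<And>y. f y \<ge> 0" and "m \<ge> 0"
    and ge: "\<And>y. y \<noteq> 0 \<Longrightarrow> norm y \<le> r \<Longrightarrow> m / (norm y)\<^sup>2 \<le> f y"
    and x: "x \<noteq> 0" "norm x \<le> r" and W: "integrable lborel (\<lambda>y. f y / norm (y - x))"
  shows "m * (4 * pi * ln (r / (2 * norm x))) \<le> (\<integral>y. f y / norm (y - x) \<partial>lborel)"
proof -
  have "ennreal (m * (4 * pi * ln (r / (2 * norm x)))) \<le> (\<integral>\<^sup>+y. ennreal (f y / norm (y - x)) \<partial>lborel)"
    using assms by (intro newton_potential_lower) auto
  also have "(\<integral>\<^sup>+y. ennreal (f y / norm (y - x)) \<partial>lborel) = ennreal (\<integral>y. f y / norm (y - x) \<partial>lborel)"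
    by (rule nn_integral_eq_integral) (use W f(2) in auto)
  finally show ?thesis
    by (subst (asm) ennreal_le_iff) (use f(2) in \<open>auto intro!: integral_nonneg_AE\<close>)
qed

text \<open>Near 0, \<open>f\<close> lies between m/|y|^2 and M/|y|^2 for any m < c < M. The terms
  depending on the radius \<open>r\<close> of that neighbourhood are constant in \<open>x\<close>
  and vanish after division by the logarithm.\<close>

lemma newton_potential_log_asymp:
  fixes f :: "real ^ 3 \<Rightarrow> real"
  assumes f: "integrable lborel f" "\<And>y. f y \<ge> 0"
    and lim: "((\<lambda>y. (norm y)\<^sup>2 * f y) \<longlongrightarrow> c) (at 0)"
    and W: "\<forall>\<^sub>F x in at 0. integrable lborel (\<lambda>y. f y / norm (y - x))"
  shows "((\<lambda>x. (\<integral>y. f y / norm (y - x) \<partial>lborel) / ln (1 / norm x)) \<longlongrightarrow> 4 * pi * c) (at 0)"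
proof (rule order_tendstoI)
  let ?W = "\<lambda>x. \<integral>y. f y / norm (y - x) \<partial>lborel"
  have ln_pos: "\<forall>\<^sub>F x::real^3 in at 0. ln (1 / norm x) > 0"
    using filterlim_ln_inverse_norm eventually_gt_at_top by (rule eventually_compose_filterlim[rotated])
  have "c \<ge> 0"
    by (rule tendsto_lowerbound[OF lim]) (use f(2) in auto)
  have get: "\<exists>r>0. r \<le> 1 \<and> (\<forall>y. y \<noteq> 0 \<longrightarrow> norm y \<le> r \<longrightarrow> P y)" if "\<forall>\<^sub>F y::real^3 in at 0. P y" for P
  proof -
    from that obtain d where "d > 0" "\<And>y. y \<noteq> 0 \<Longrightarrow> norm y < d \<Longrightarrow> P y"
      by (auto simp: eventually_at)
    \<comment> \<open>Halving d turns the strict inequality into \<open>norm y \<le> r\<close>; the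
      cap 1 is what \<open>newton_potential_le\<close> asks of the radius.\<close>
    then show ?thesis by (intro exI[of _ "min (d / 2) 1"]) auto
  qed
  {
    fix u assume "4 * pi * c < u"
    then have "c < u / (4 * pi)" by (simp add: field_simps)
    then obtain M where M: "c < M" "M < u / (4 * pi)" using dense by blast
    then have "\<forall>\<^sub>F y in at 0. (norm y)\<^sup>2 * f y < M" using lim by (intro order_tendstoD)
    from get[OF this] obtain r where r: "r > 0" "r \<le> 1" "\<And>y. y \<noteq> 0 \<Longrightarrow> norm y \<le> r \<Longrightarrow> (norm y)\<^sup>2 * f y < M"
      by blast
    have le: "f y \<le> M / (norm y)\<^sup>2" if "y \<noteq> 0" "norm y \<le> r" for y
      using r(3)[OF that] that by (simp add: field_simps)
    define K where "K = 2 / r * integral\<^sup>L lborel f + M * (76 * pi)"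
    have "((\<lambda>x::real^3. K / ln (1 / norm x) + 4 * pi * M) \<longlongrightarrow> 0 + 4 * pi * M) (at 0)"
      by (intro tendsto_add real_tendsto_divide_at_top[OF tendsto_const] filterlim_ln_inverse_norm) (rule tendsto_const)
    then have "\<forall>\<^sub>F x::real^3 in at 0. K / ln (1 / norm x) + 4 * pi * M < u"
      using M by (intro order_tendstoD) (auto simp: field_simps)
    moreover have "\<forall>\<^sub>F x::real^3 in at 0. x \<noteq> 0 \<and> norm x < r / 2"
      using r(1) by (intro eventually_at_0_norm) auto
    ultimately show "\<forall>\<^sub>F x in at 0. ?W x / ln (1 / norm x) < u"
      using ln_pos W
    proof eventually_elim
      case (elim x)
      have "?W x \<le> K + 4 * pi * M * ln (1 / norm x)"
        using newton_potential_le[OF f _ r(1,2) le, of x] elim M \<open>c \<ge> 0\<close> by (simp add: K_def algebra_simps)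
      then have "?W x / ln (1 / norm x) \<le> K / ln (1 / norm x) + 4 * pi * M"
        using elim(3) by (simp add: divide_le_eq distrib_right)
      then show ?case using elim(1) by linarith
    qed
  next
    fix u assume u: "u < 4 * pi * c"
    show "\<forall>\<^sub>F x in at 0. u < ?W x / ln (1 / norm x)"
    \<comment> \<open>The lower estimate needs m >= 0. For u >= 0 any \<open>m\<close> above u / (4
      pi) qualifies; for u < 0, which includes every case with c = 0, the sign of the potential is
      enough.\<close>
    proof (cases "u < 0")
      case True
      from ln_pos show ?thesis
      proof eventually_elim
        case (elim x)
        have "0 \<le> ?W x / ln (1 / norm x)"
          using elim f(2) by (intro divide_nonneg_pos integral_nonneg_AE) auto
        then show ?case using True by linarith
      qed
    next
      case False
      have "u / (4 * pi) < c" using u by (simp add: field_simps)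
      then obtain m where m: "u / (4 * pi) < m" "m < c" using dense by blast
      moreover have "0 \<le> u / (4 * pi)" using False by simp
      ultimately have "m \<ge> 0" by linarith
      have "\<forall>\<^sub>F y in at 0. m < (norm y)\<^sup>2 * f y" using lim m by (intro order_tendstoD)
      from get[OF this] obtain r where r: "r > 0" "r \<le> 1" "\<And>y. y \<noteq> 0 \<Longrightarrow> norm y \<le> r \<Longrightarrow> m < (norm y)\<^sup>2 * f y"
        by blast
      have ge: "m / (norm y)\<^sup>2 \<le> f y" if "y \<noteq> 0" "norm y \<le> r" for y
        using r(3)[OF that] that by (simp add: field_simps)
      define K where "K = 4 * pi * m * ln (r / 2)"
      have "((\<lambda>x::real^3. K / ln (1 / norm x) + 4 * pi * m) \<longlongrightarrow> 0 + 4 * pi * m) (at 0)"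
        by (intro tendsto_add real_tendsto_divide_at_top[OF tendsto_const] filterlim_ln_inverse_norm) (rule tendsto_const)
      then have "\<forall>\<^sub>F x::real^3 in at 0. u < K / ln (1 / norm x) + 4 * pi * m"
        using m by (intro order_tendstoD) (auto simp: field_simps)
      moreover have "\<forall>\<^sub>F x::real^3 in at 0. x \<noteq> 0 \<and> norm x < r"
        using r(1) by (rule eventually_at_0_norm)
      ultimately show ?thesis
        using ln_pos W
      proof eventually_elim
        case (elim x)
        have "ln (r / (2 * norm x)) = ln (r / 2) + ln (1 / norm x)"
          using elim(2) r(1) by (simp add: ln_div ln_mult)
        then have "K + 4 * pi * m * ln (1 / norm x) \<le> ?W x"
          using newton_potential_ge[OF f \<open>m \<ge> 0\<close> ge, of r x] elim by (simp add: K_def algebra_simps)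
        then have "K / ln (1 / norm x) + 4 * pi * m \<le> ?W x / ln (1 / norm x)"
          using elim(3) by (simp add: le_divide_eq distrib_right)
        then show ?case using elim(1) by linarith
      qed
    qed
  }
qed

section \<open>Bootstrap from the representation to the expansion at the origin\<close>

theorem theorem1p9:
  fixes l :: real and V :: "real ^ 3 \<Rightarrow> real"
  assumes "l > 0"
    and "positive_solution l V"
  shows "((\<lambda>x. (V x - l / (2 * pi * norm x)) /
               (l\<^sup>2 * ln (1 / norm x) / (4 * pi\<^sup>2))) \<longlongrightarrow> -1) (at 0)"
proof -
  obtain f C where f: "integrable lborel f" "\<And>y. f y \<ge> 0" "\<And>y. norm y < 1 \<Longrightarrow> f y = (V y)\<^sup>2"
    and W: "\<And>x. x \<noteq> 0 \<Longrightarrow> norm x < 1 / 2 \<Longrightarrow> integrable lborel (\<lambda>y. f y / norm (y - x))"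
    and rep: "\<And>x. x \<noteq> 0 \<Longrightarrow> norm x < 1 / 2 \<Longrightarrow>
       \<bar>4 * pi * V x - 2 * l / norm x + (\<integral>y. f y / norm (y - x) \<partial>lborel)\<bar> \<le> C"
    using positive_solution_representation[OF assms] by blast
  have Vpos: "V x > 0" if "x \<noteq> 0" for x
    using assms(2) that unfolding positive_solution_def by blast
  define W where "W = (\<lambda>x. \<integral>y. f y / norm (y - x) \<partial>lborel)"
  have W0: "W x \<ge> 0" for x unfolding W_def using f(2) by (intro integral_nonneg_AE) auto
  define a where "a = l / (2 * pi)"
  have a: "a > 0" "l = 2 * pi * a" using \<open>l > 0\<close> by (auto simp: a_def)
  define E where "E = (\<lambda>x. 4 * pi * V x - 2 * l / norm x + W x)"
  have E: "\<bar>E x\<bar> \<le> C" if "x \<noteq> 0" "norm x < 1 / 2" for x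
    using rep[OF that] by (simp add: E_def W_def)
  have V_eq: "V x = a / norm x + (E x - W x) / (4 * pi)" for x
    by (simp add: E_def a(2) field_simps)
  \<comment> \<open>The representation holds for |x| < 1/2; the potential estimate is applied with
    radius 1/4, which asks for |x| < 1/8.\<close>
  have near: "\<forall>\<^sub>F x::real^3 in at 0. x \<noteq> 0 \<and> norm x < 1 / 8"
    by (rule eventually_at_0_norm) simp
  \<comment> \<open>Crude constant: dropping -W leaves V <= a/|y| + C/(4 pi), and C/(4 pi) <= C/|y|
    because |y| <= 1.\<close>
  define M where "M = (a + C)\<^sup>2"
  have f_le: "f y \<le> M / (norm y)\<^sup>2" if "y \<noteq> 0" "norm y \<le> 1 / 4" for y
  proof -
    have "E y \<le> C" "C \<ge> 0" using E[of y] that by auto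
    have "(E y - W y) / (4 * pi) \<le> C / (4 * pi)"
      using W0[of y] \<open>E y \<le> C\<close> by (intro divide_right_mono) auto
    also have "\<dots> \<le> C / 1" using \<open>C \<ge> 0\<close> pi_gt3 by (intro divide_left_mono) auto
    also have "\<dots> \<le> C / norm y" using \<open>C \<ge> 0\<close> that by (intro divide_left_mono) auto
    finally have "V y \<le> (a + C) / norm y" using V_eq[of y] by (simp add: add_divide_distrib)
    \<comment> \<open>Positivity of \<open>V\<close> lets the one-sided bound be squared.\<close>
    then have "(V y)\<^sup>2 \<le> ((a + C) / norm y)\<^sup>2" using Vpos[of y] that by (intro power_mono) auto
    then show ?thesis using f(3)[of y] that by (simp add: M_def power_divide)
  qed
  define K where "K = 8 * integral\<^sup>L lborel f + M * (76 * pi)"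
  have W_le: "W x \<le> K + M * (4 * pi) * ln (1 / norm x)" if "x \<noteq> 0" "norm x < 1 / 8" for x
    using newton_potential_le[of f M "1 / 4" x] f(1,2) f_le W[of x] that
    by (simp add: W_def K_def M_def algebra_simps)
  have "((\<lambda>t::real. t * (K + M * (4 * pi) * ln (1 / t))) \<longlongrightarrow> 0) (at_right 0)"
    by real_asymp
  then have "((\<lambda>x::real^3. norm x * (K + M * (4 * pi) * ln (1 / norm x))) \<longlongrightarrow> 0) (at 0)"
    by (rule filterlim_compose[OF _ filterlim_norm_at_right_0])
  then have xW: "((\<lambda>x. norm x * W x) \<longlongrightarrow> 0) (at 0)"
  proof (rule tendsto_sandwich[OF _ _ tendsto_const, rotated 2])
    show "\<forall>\<^sub>F x in at 0. norm x * W x \<le> norm x * (K + M * (4 * pi) * ln (1 / norm x))"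
      using near by eventually_elim (intro mult_left_mono W_le, auto)
  qed (simp add: W0)
  have xE: "((\<lambda>x. norm x * E x) \<longlongrightarrow> 0) (at 0)"
  proof (rule Lim_null_comparison)
    show "\<forall>\<^sub>F x in at 0. norm (norm x * E x) \<le> norm x * C"
      using near by eventually_elim (auto simp: abs_mult intro!: mult_left_mono E)
    show "((\<lambda>x::real^3. norm x * C) \<longlongrightarrow> 0) (at 0)" by (auto intro!: tendsto_eq_intros)
  qed
  \<comment> \<open>The crude \<open>M\<close> drops out: multiplied by |x|, both corrections
    vanish, so the limit is exactly \<open>a\<close>.\<close>
  have "((\<lambda>x. a + (norm x * E x - norm x * W x) / (4 * pi)) \<longlongrightarrow> a + (0 - 0) / (4 * pi)) (at 0)"
    by (intro tendsto_intros xE xW) auto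
  moreover have "\<forall>\<^sub>F x in at 0. a + (norm x * E x - norm x * W x) / (4 * pi) = norm x * V x"
    using near by eventually_elim (auto simp: V_eq field_simps)
  ultimately have "((\<lambda>x. norm x * V x) \<longlongrightarrow> a) (at 0)"
    using Lim_transform_eventually by fastforce
  then have "((\<lambda>x. (norm x * V x)\<^sup>2) \<longlongrightarrow> a\<^sup>2) (at 0)" by (rule tendsto_power)
  moreover have "\<forall>\<^sub>F x in at 0. (norm x * V x)\<^sup>2 = (norm x)\<^sup>2 * f x"
    using near by eventually_elim (auto simp: f(3) power_mult_distrib)
  ultimately have "((\<lambda>x. (norm x)\<^sup>2 * f x) \<longlongrightarrow> a\<^sup>2) (at 0)"
    by (rule Lim_transform_eventually)
  then have W_lim: "((\<lambda>x. W x / ln (1 / norm x)) \<longlongrightarrow> 4 * pi * a\<^sup>2) (at 0)"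
    unfolding W_def using f(1,2)
    by (intro newton_potential_log_asymp eventually_mono[OF near] W) auto
  have E_lim: "((\<lambda>x. E x / ln (1 / norm x)) \<longlongrightarrow> 0) (at 0)"
  proof (rule Lim_null_comparison)
    show "\<forall>\<^sub>F x in at 0. norm (E x / ln (1 / norm x)) \<le> C / ln (1 / norm x)"
      using near
    proof eventually_elim
      case (elim x)
      then have "ln (1 / norm x) \<ge> 0" by (intro ln_ge_zero) auto
      then show ?case using E[of x] elim by (simp only: real_norm_def abs_divide) (auto intro: divide_right_mono)
    qed
    show "((\<lambda>x::real^3. C / ln (1 / norm x)) \<longlongrightarrow> 0) (at 0)"
      by (rule real_tendsto_divide_at_top[OF tendsto_const filterlim_ln_inverse_norm])
  qed
  have "((\<lambda>x. (E x / ln (1 / norm x) - W x / ln (1 / norm x)) / (4 * pi * a\<^sup>2))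
      \<longlongrightarrow> (0 - 4 * pi * a\<^sup>2) / (4 * pi * a\<^sup>2)) (at 0)"
    using a(1) by (intro tendsto_intros E_lim W_lim) auto
  \<comment> \<open>Where the logarithm is 0, both sides are 0 by the convention for division by 0,
    so the identity holds for every \<open>x\<close>.\<close>
  moreover have "(E x / ln (1 / norm x) - W x / ln (1 / norm x)) / (4 * pi * a\<^sup>2)
     = (V x - l / (2 * pi * norm x)) / (l\<^sup>2 * ln (1 / norm x) / (4 * pi\<^sup>2))" for x
  proof -
    have "V x - l / (2 * pi * norm x) = (E x - W x) / (4 * pi)"
      using V_eq[of x] by (simp add: a(2))
    moreover have "l\<^sup>2 * ln (1 / norm x) / (4 * pi\<^sup>2) = a\<^sup>2 * ln (1 / norm x)"
      by (simp add: a(2) power_mult_distrib)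
    ultimately show ?thesis by (simp add: diff_divide_distrib mult_ac)
  qed
  ultimately show ?thesis using a(1) by simp
qed

end
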